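(* Let $b=\{b_I\}_{I\in\mathcal D}$ and $d=\{d_I\}_{I\in\mathcal D}$ be sequences of complex numbers indexed by the dyadic intervals, and let $b\circ d=\{b_Id_I\}_{I\in\mathcal D}$. (i) The composition $\mathsf P_b^{(0,0)}\circ\mathsf P_d^{(0,1)}$ is bounded on $L^2(\mathbb R)$ if and only if $\|b\circ d\|_{CM}<\infty$, and likewise $\mathsf P_b^{(1,0)}\circ\mathsf P_d^{(0,0)}$ is bounded on $L^2(\mathbb R)$ if and only if $\|b\circ d\|_{CM}<\infty$. Moreover, $$\left\|\mathsf P_b^{(0,0)}\circ\mathsf P_d^{(0,1)}\right\|_{L^2(\mathbb R)\to L^2(\mathbb R)}=\left\|\mathsf P_b^{(1,0)}\circ\mathsf P_d^{(0,0)}\right\|_{L^2(\mathbb R)\to L^2(\mathbb R)}\approx\|b\circ d\|_{CM}.$$ (ii) The composition $\mathsf P_b^{(0,0)}\circ\mathsf P_d^{(0,0)}$ is bounded on $L^2(\mathbb R)$ if and only if $\|b\circ d\|_{\ell^\infty}<\infty$. Moreover, $$\left\|\mathsf P_b^{(0,0)}\circ\mathsf P_d^{(0,0)}\right\|_{L^2(\mathbb R)\to L^2(\mathbb R)}\approx\|b\circ d\|_{\ell^\infty}.$$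
   Context: $\mathcal D$ is the standard grid of dyadic intervals $[k2^j,(k+1)2^j)$, $j,k\in\mathbb Z$, of $\mathbb R$; $I_-$ and $I_+$ are the left and right halves of $I$; $J\subset I$ allows $J=I$. For $I\in\mathcal D$, $h_I=h_I^0=|I|^{-1/2}(-\mathbf 1_{I_-}+\mathbf 1_{I_+})$ (Haar function) and $h_I^1=|I|^{-1}\mathbf 1_I$ (averaging function). For a complex sequence $b=\{b_I\}_{I\in\mathcal D}$ and $(\alpha,\beta)\in\{0,1\}^2$, the dyadic paraproduct is $$\mathsf P_b^{(\alpha,\beta)}f=\sum_{I\in\mathcal D}b_I\langle f,h_I^\beta\rangle_{L^2(\mathbb R)}h_I^\alpha .$$ For a sequence $a$: $\|a\|_{\ell^\infty}=\sup_{I\in\mathcal D}|a_I|$ and $\|a\|_{CM}=\Big(\sup_{I\in\mathcal D}\frac1{|I|}\sum_{J\subset I}|a_J|^2\Big)^{1/2}$. The individual paraproducts may be unbounded. Compositions are defined initially on finite linear combinations $f$ of Haar functions: $\mathsf P_d^{(0,\delta)}f$ is the (formal) Haar series with coefficients $d_I\langle f,h_I^\delta\rangle$, and $\mathsf P_b^{(\alpha,0)}$ acts on a Haar series $\sum_I c_Ih_I$ by $\sum_I b_Ic_Ih_I^\alpha$. The $L^2$ norm of a Haar series $\sum_I c_Ih_I$ is $(\sum_I|c_I|^2)^{1/2}\in[0,\infty]$. The operator norm is the supremum of the $L^2$ norm of the image over such $f$ with $\|f\|_{L^2(\mathbb R)}\le1$ (possibly $+\infty$), and bounded means this is finite. $A\approx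 B$ means $cB\le A\le CB$ with absolute constants $0<c\le C<\infty$ (independent of $b,d$). *)

theory Defs
  imports "HOL-Analysis.Analysis"
begin

section \<open>Dyadic intervals and Haar functions\<close>

definition dyadic_intervals :: "real set set" where
  "dyadic_intervals =
     {I. \<exists>j k :: int. I = {of_int k * 2 powi j ..< (of_int k + 1) * 2 powi j}}"

abbreviation len :: "real set \<Rightarrow> real" where
  "len I \<equiv> measure lborel I"

definition left_half :: "real set \<Rightarrow> real set" where
  "left_half I = {x \<in> I. x < (Inf I + Sup I) / 2}"

definition right_half :: "real set \<Rightarrow> real set" where
  "right_half I = {x \<in> I. (Inf I + Sup I) / 2 \<le> x}"

text \<open>The superscript \<open>\<alpha>\<close> is \<open>0\<close> for the Haar function and \<open>1\<close> for the averaging function;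
  other values of \<open>\<alpha>\<close> are never used.\<close>

definition haar :: "nat \<Rightarrow> real set \<Rightarrow> real \<Rightarrow> complex" where
  "haar \<alpha> I x =
     (if \<alpha> = 0
      then of_real (1 / sqrt (len I)) * (- indicator (left_half I) x + indicator (right_half I) x)
      else of_real (1 / len I) * indicator I x)"


section \<open>Norms\<close>

definition ennsqrt :: "ennreal \<Rightarrow> ennreal" where
  "ennsqrt x = (if x = \<infinity> then \<infinity> else ennreal (sqrt (enn2real x)))"

definition L2_inner :: "(real \<Rightarrow> complex) \<Rightarrow> (real \<Rightarrow> complex) \<Rightarrow> complex" where
  "L2_inner f g = (LINT x|lborel. f x * cnj (g x))"

definition L2_norm :: "(real \<Rightarrow> complex) \<Rightarrow> ennreal" where
  "L2_norm f = ennsqrt (\<integral>\<^sup>+ x. ennreal ((cmod (f x))\<^sup>2) \<partial>lborel)"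

text \<open>Complex sequences indexed by the dyadic intervals are functions on \<^typ>\<open>real set\<close>
  of which only the values on \<^const>\<open>dyadic_intervals\<close> are ever used.
  Unordered sums in \<^typ>\<open>ennreal\<close> always exist.\<close>

definition linf_norm :: "(real set \<Rightarrow> complex) \<Rightarrow> ennreal" where
  "linf_norm a = (SUP I\<in>dyadic_intervals. ennreal (cmod (a I)))"

definition CM_norm :: "(real set \<Rightarrow> complex) \<Rightarrow> ennreal" where
  "CM_norm a =
     ennsqrt (SUP I\<in>dyadic_intervals.
       ennreal (1 / len I) *
       (\<Sum>\<^sub>\<infinity>J\<in>{J \<in> dyadic_intervals. J \<subseteq> I}. ennreal ((cmod (a J))\<^sup>2)))"

text \<open>A formal Haar series \<open>\<Sum>\<^sub>I c\<^sub>I h\<^sub>I\<close> is represented by its coefficient sequence \<open>c\<close>.\<close>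

definition haar_series_norm :: "(real set \<Rightarrow> complex) \<Rightarrow> ennreal" where
  "haar_series_norm c = ennsqrt (\<Sum>\<^sub>\<infinity>I\<in>dyadic_intervals. ennreal ((cmod (c I))\<^sup>2))"


section \<open>Paraproducts\<close>

text \<open>\<open>P\<^sub>d\<^sup>(\<^sup>0\<^sup>,\<^sup>\<delta>\<^sup>) f\<close>, as a formal Haar series.\<close>

definition paraproduct_0 ::
    "nat \<Rightarrow> (real set \<Rightarrow> complex) \<Rightarrow> (real \<Rightarrow> complex) \<Rightarrow> (real set \<Rightarrow> complex)" where
  "paraproduct_0 \<delta> d f = (\<lambda>I. d I * L2_inner f (haar \<delta> I))"

text \<open>\<open>P\<^sub>b\<^sup>(\<^sup>0\<^sup>,\<^sup>0\<^sup>)\<close> on a Haar series; the result is again a formal Haar series.\<close>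

definition series_paraproduct_00 ::
    "(real set \<Rightarrow> complex) \<Rightarrow> (real set \<Rightarrow> complex) \<Rightarrow> (real set \<Rightarrow> complex)" where
  "series_paraproduct_00 b c = (\<lambda>I. b I * c I)"

text \<open>\<open>P\<^sub>b\<^sup>(\<^sup>1\<^sup>,\<^sup>0\<^sup>)\<close> on a Haar series; the result is a function. It is only applied to series with
  finitely many nonzero coefficients, for which the infinite sum is a finite one.\<close>

definition series_paraproduct_10 ::
    "(real set \<Rightarrow> complex) \<Rightarrow> (real set \<Rightarrow> complex) \<Rightarrow> (real \<Rightarrow> complex)" where
  "series_paraproduct_10 b c = (\<lambda>x. \<Sum>\<^sub>\<infinity>I\<in>dyadic_intervals. b I * c I * haar 1 I x)"

definition haar_span :: "(real \<Rightarrow> complex) set" where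
  "haar_span =
     {f. \<exists>F c. finite F \<and> F \<subseteq> dyadic_intervals \<and> f = (\<lambda>x. \<Sum>I\<in>F. c I * haar 0 I x)}"

text \<open>The first argument is the \<open>L\<^sup>2\<close> norm on the target: \<^const>\<open>haar_series_norm\<close> for
  operators with values in formal Haar series, \<^const>\<open>L2_norm\<close> for function-valued ones.\<close>

definition op_norm :: "('a \<Rightarrow> ennreal) \<Rightarrow> ((real \<Rightarrow> complex) \<Rightarrow> 'a) \<Rightarrow> ennreal" where
  "op_norm N T = (SUP f\<in>{f \<in> haar_span. L2_norm f \<le> 1}. N (T f))"

definition norm_00_01 :: "(real set \<Rightarrow> complex) \<Rightarrow> (real set \<Rightarrow> complex) \<Rightarrow> ennreal" where
  "norm_00_01 b d = op_norm haar_series_norm (series_paraproduct_00 b \<circ> paraproduct_0 1 d)"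

definition norm_10_00 :: "(real set \<Rightarrow> complex) \<Rightarrow> (real set \<Rightarrow> complex) \<Rightarrow> ennreal" where
  "norm_10_00 b d = op_norm L2_norm (series_paraproduct_10 b \<circ> paraproduct_0 0 d)"

definition norm_00_00 :: "(real set \<Rightarrow> complex) \<Rightarrow> (real set \<Rightarrow> complex) \<Rightarrow> ennreal" where
  "norm_00_00 b d = op_norm haar_series_norm (series_paraproduct_00 b \<circ> paraproduct_0 0 d)"

text \<open>\<open>A \<approx> B\<close> for quantities depending on two sequences, with constants independent of them.\<close>

definition comparable ::
    "('a \<Rightarrow> 'b \<Rightarrow> ennreal) \<Rightarrow> ('a \<Rightarrow> 'b \<Rightarrow> ennreal) \<Rightarrow> bool" where
  "comparable A B \<longleftrightarrow>
     (\<exists>c C :: real. 0 < c \<and> c \<le> C \<and>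
        (\<forall>b d. ennreal c * B b d \<le> A b d \<and> A b d \<le> ennreal C * B b d))"

end

theory Submission
  imports Defs
begin

text \<open>Only the products \<open>a\<^sub>I = b\<^sub>I d\<^sub>I\<close> matter. The upper bound for \<open>P\<^sub>b\<^sup>(\<^sup>0\<^sup>,\<^sup>0\<^sup>) P\<^sub>d\<^sup>(\<^sup>0\<^sup>,\<^sup>1\<^sup>)\<close> is the dyadic
  Carleson embedding theorem. With \<open>x\<^sub>I\<close> the modulus of the average of \<open>f\<close> over \<open>I\<close> and
  \<open>A\<^sub>I = |I|\<^sup>-\<^sup>1 \<Sum>\<^bsub>J \<subseteq> I\<^esub> |a\<^sub>J|\<^sup>2 \<le> M\<close>, the function \<open>x\<^sup>2 / (M + A)\<close> is jointly convex and decreases in \<open>A\<close> at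
  rate at least \<open>x\<^sup>2 / (4 M\<^sup>2)\<close>. Passing from an interval to its halves, its average therefore grows by at
  least \<open>|a\<^sub>I|\<^sup>2 x\<^sub>I\<^sup>2 / (4 M\<^sup>2 |I|)\<close>, and these gains telescope. The lower bound comes from testing on single
  Haar functions. The two operators of part (i) are adjoint to each other up to complex conjugation, so
  their norms agree because the span of the Haar functions is dense in the \<open>L\<^sup>2\<close> closure of the
  step functions. Part (ii) is orthonormality of the Haar functions.\<close>

section \<open>Dyadic intervals\<close>

definition dyadic :: "int \<Rightarrow> int \<Rightarrow> real set" where
  "dyadic j k = {of_int k * 2 powi j ..< (of_int k + 1) * 2 powi j}"

lemma dyadic_intervals_eq: "dyadic_intervals = {dyadic j k |j k. True}"
  unfolding dyadic_intervals_def dyadic_def by auto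

lemma dyadic_in [simp]: "dyadic j k \<in> dyadic_intervals"
  unfolding dyadic_intervals_eq by auto

text \<open>At a fixed scale the position of the interval containing \<open>x\<close> is a floor, so
  nesting of dyadic intervals becomes integer division.\<close>

lemma mem_dyadic_iff: "x \<in> dyadic j k \<longleftrightarrow> \<lfloor>x / 2 powi j\<rfloor> = k"
  unfolding dyadic_def by (simp add: floor_eq_iff field_simps)

lemma len_dyadic [simp]: "len (dyadic j k) = 2 powi j"
  unfolding dyadic_def by (simp add: algebra_simps)

lemma dyadic_nonempty: "dyadic j k \<noteq> {}"
  unfolding dyadic_def by (simp add: algebra_simps)

lemma dyadic_borel [measurable]: "dyadic j k \<in> sets borel"
  unfolding dyadic_def by simp

lemma emeasure_dyadic: "emeasure lborel (dyadic j k) = ennreal (2 powi j)"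
  unfolding dyadic_def by (simp add: algebra_simps)

lemma dyadic_halves:
  shows "left_half (dyadic j k) = dyadic (j - 1) (2 * k)"
    and "right_half (dyadic j k) = dyadic (j - 1) (2 * k + 1)"
proof -
  have p: "(2::real) powi j = 2 * 2 powi (j - 1)"
    by (simp add: power_int_diff)
  have q: "(2::real) powi (j - 1) > 0" by simp
  have lt: "of_int k * 2 powi j < (of_int k + 1) * (2::real) powi j"
    by (simp add: algebra_simps)
  have ends: "Inf (dyadic j k) = of_int k * 2 powi j" "Sup (dyadic j k) = (of_int k + 1) * 2 powi j"
    unfolding dyadic_def using lt by (auto intro: cInf_atLeastLessThan cSup_atLeastLessThan)
  have mid: "(Inf (dyadic j k) + Sup (dyadic j k)) / 2 = (2 * of_int k + 1) * 2 powi (j - 1)"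
    unfolding ends p by (simp add: algebra_simps)
  show "left_half (dyadic j k) = dyadic (j - 1) (2 * k)"
    "right_half (dyadic j k) = dyadic (j - 1) (2 * k + 1)"
    unfolding left_half_def right_half_def mid unfolding dyadic_def p
    using q by (auto simp: algebra_simps)
qed

text \<open>The position of \<open>x\<close> at the coarser scale \<open>j\<close> is its position
  at scale \<open>i\<close> divided by \<open>2 ^ (j - i)\<close>, so all points of a fine interval
  share one coarse interval.\<close>

lemma dyadic_subset_or_disjoint:
  assumes "i \<le> j"
  shows "dyadic i l \<subseteq> dyadic j k \<or> dyadic i l \<inter> dyadic j k = {}"
proof -
  define n where "n = nat (j - i)"
  have "(2::real) powi j = 2 powi (i + int n)"
    using assms by (simp add: n_def)
  also have "\<dots> = 2 powi i * of_int (2 ^ n)"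
    by (simp add: power_int_add)
  finally have j: "(2::real) powi j = 2 powi i * of_int (2 ^ n)" .
  have "\<lfloor>x / 2 powi j\<rfloor> = \<lfloor>x / 2 powi i\<rfloor> div 2 ^ n" for x :: real
    unfolding j divide_divide_eq_left[symmetric] by (rule floor_divide_real_eq_div) simp
  then show ?thesis by (auto simp: mem_dyadic_iff)
qed

lemma dyadic_emptyI: "I \<in> dyadic_intervals \<Longrightarrow> I \<noteq> {}"
  by (auto simp: dyadic_intervals_eq dyadic_nonempty)

lemma dyadic_sets [measurable (raw)]: "I \<in> dyadic_intervals \<Longrightarrow> I \<in> sets borel"
  by (auto simp: dyadic_intervals_eq)

lemma dyadic_emeasure: "I \<in> dyadic_intervals \<Longrightarrow> emeasure lborel I = ennreal (len I)"
  by (auto simp: dyadic_intervals_eq emeasure_dyadic)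

lemma len_pos: "I \<in> dyadic_intervals \<Longrightarrow> 0 < len I"
  by (auto simp: dyadic_intervals_eq)

lemma half_in:
  assumes "I \<in> dyadic_intervals"
  shows "left_half I \<in> dyadic_intervals" "right_half I \<in> dyadic_intervals"
proof -
  obtain j k where "I = dyadic j k"
    using assms by (auto simp: dyadic_intervals_eq)
  then show "left_half I \<in> dyadic_intervals" "right_half I \<in> dyadic_intervals"
    by (simp_all add: dyadic_halves)
qed

lemma len_half:
  assumes "I \<in> dyadic_intervals"
  shows "len (left_half I) = len I / 2" "len (right_half I) = len I / 2"
  using assms by (auto simp: dyadic_intervals_eq dyadic_halves power_int_diff)

lemma halves_Un: "left_half I \<union> right_half I = I"
  unfolding left_half_def right_half_def by auto

lemma halves_disjoint: "left_half I \<inter> right_half I = {}"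
  unfolding left_half_def right_half_def by auto

section \<open>The dyadic tree\<close>

text \<open>The parent has position \<open>k div 2\<close> one scale up; the parity of
  \<open>k\<close> decides which half \<open>I\<close> is.\<close>

lemma dyadic_parent:
  assumes "I \<in> dyadic_intervals"
  obtains P where "P \<in> dyadic_intervals" "I = left_half P \<or> I = right_half P"
proof -
  obtain j k where I: "I = dyadic j k"
    using assms by (auto simp: dyadic_intervals_eq)
  have "left_half (dyadic (j + 1) (k div 2)) = dyadic j (2 * (k div 2))"
    "right_half (dyadic (j + 1) (k div 2)) = dyadic j (2 * (k div 2) + 1)"
    by (simp_all add: dyadic_halves)
  moreover have "k = 2 * (k div 2) \<or> k = 2 * (k div 2) + 1" by presburger
  ultimately show ?thesis using that[of "dyadic (j + 1) (k div 2)"] I by force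
qed

lemma dyadic_nested:
  assumes "I \<in> dyadic_intervals" "J \<in> dyadic_intervals"
  shows "I \<inter> J = {} \<or> I \<subseteq> J \<or> J \<subseteq> I"
proof -
  obtain i k j l where "I = dyadic i k" "J = dyadic j l"
    using assms by (auto simp: dyadic_intervals_eq)
  then show ?thesis
    using dyadic_subset_or_disjoint[of i j k l] dyadic_subset_or_disjoint[of j i l k]
    by (cases "i \<le> j") auto
qed

text \<open>At a strictly smaller scale the nonempty \<open>J\<close> lies in whichever half of
  \<open>I\<close> it meets; at the same or a larger scale nesting also gives
  \<open>I \<subseteq> J\<close> and hence equality.\<close>

lemma dyadic_subset_cases:
  assumes "I \<in> dyadic_intervals" "J \<in> dyadic_intervals" "J \<subseteq> I"
  shows "J = I \<or> J \<subseteq> left_half I \<or> J \<subseteq> right_half I"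
proof -
  obtain i k j l where I: "I = dyadic i k" and J: "J = dyadic j l"
    using assms by (auto simp: dyadic_intervals_eq)
  show ?thesis
  proof (cases "j \<le> i - 1")
    case True
    have "J \<noteq> {}" using J dyadic_nonempty by simp
    then show ?thesis
      using dyadic_subset_or_disjoint[OF True, of l "2 * k"]
        dyadic_subset_or_disjoint[OF True, of l "2 * k + 1"]
        assms(3) halves_Un[of I]
      unfolding I J dyadic_halves by blast
  next
    case False
    then have "I \<subseteq> J"
      using dyadic_subset_or_disjoint[of i j k l] assms(3) dyadic_nonempty[of j l]
      unfolding I J by auto
    with assms(3) show ?thesis by blast
  qed
qed

lemma half_not_superset:
  assumes "I \<in> dyadic_intervals"
  shows "\<not> I \<subseteq> left_half I" "\<not> I \<subseteq> right_half I"
  using halves_Un[of I] halves_disjoint[of I] dyadic_emptyI[OF half_in(1)[OF assms]]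
    dyadic_emptyI[OF half_in(2)[OF assms]] by blast+

lemma len_mono:
  assumes "I \<in> dyadic_intervals" "J \<in> dyadic_intervals" "J \<subseteq> I"
  shows "len J \<le> len I"
  using assms dyadic_emeasure[OF assms(1)]
  by (intro measure_mono_fmeasurable) (auto simp: fmeasurable_def)


section \<open>Square integrable functions\<close>

definition sqint :: "(real \<Rightarrow> complex) \<Rightarrow> bool" where
  "sqint f \<longleftrightarrow> f \<in> borel_measurable lborel \<and> integrable lborel (\<lambda>x. (cmod (f x))\<^sup>2)"

text \<open>Real-valued form of the \<open>L^2\<close> norm. A non-integrable square has Bochner
  integral \<open>0\<close>, so the value is meaningful only together with \<open>sqint\<close>;
  \<open>L2_norm_eq\<close> then identifies it with \<open>L2_norm\<close>.\<close>

definition nrm :: "(real \<Rightarrow> complex) \<Rightarrow> real" where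
  "nrm f = sqrt (LINT x|lborel. (cmod (f x))\<^sup>2)"

lemma nrm_nonneg [simp]: "0 \<le> nrm f"
  unfolding nrm_def by simp

lemma nrm_sq: "(nrm f)\<^sup>2 = (LINT x|lborel. (cmod (f x))\<^sup>2)"
  unfolding nrm_def by simp

lemma sqint_measurable: "sqint f \<Longrightarrow> f \<in> borel_measurable lborel"
  unfolding sqint_def by simp

lemma sqint_integrable: "sqint f \<Longrightarrow> integrable lborel (\<lambda>x. (cmod (f x))\<^sup>2)"
  unfolding sqint_def by simp

lemma integrable_cmod_prod:
  assumes "sqint f" "sqint g"
  shows "integrable lborel (\<lambda>x. cmod (f x) * cmod (g x))"
proof (rule Bochner_Integration.integrable_bound)
  show "integrable lborel (\<lambda>x. (cmod (f x))\<^sup>2 + (cmod (g x))\<^sup>2)"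
    using assms by (intro Bochner_Integration.integrable_add sqint_integrable)
  show "(\<lambda>x. cmod (f x) * cmod (g x)) \<in> borel_measurable lborel"
    using assms[THEN sqint_measurable] by measurable
  have "u * v \<le> u\<^sup>2 + v\<^sup>2" if "u \<ge> 0" "v \<ge> 0" for u v :: real
    using sum_squares_bound[of u v] mult_nonneg_nonneg[OF that] by simp
  then show "AE x in lborel. norm (cmod (f x) * cmod (g x))
      \<le> norm ((cmod (f x))\<^sup>2 + (cmod (g x))\<^sup>2)"
    by auto
qed

lemma integrable_prod:
  assumes "sqint f" "sqint g"
  shows "integrable lborel (\<lambda>x. f x * g x)"
  using integrable_cmod_prod[OF assms]
  by (rule Bochner_Integration.integrable_bound)
    (use assms[THEN sqint_measurable] in \<open>auto simp: norm_mult\<close>)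

lemma sqint_cnj: "sqint f \<Longrightarrow> sqint (\<lambda>x. cnj (f x))"
  unfolding sqint_def
  using measurable_compose[OF _ borel_measurable_continuous_onI[OF continuous_on_cnj[OF continuous_on_id]]]
  by auto

lemma nrm_cnj: "nrm (\<lambda>x. cnj (f x)) = nrm f"
  unfolding nrm_def by simp

lemma sqint_scale: "sqint f \<Longrightarrow> sqint (\<lambda>x. c * f x)"
  unfolding sqint_def by (auto simp: norm_mult power_mult_distrib)

lemma nrm_scale: "nrm (\<lambda>x. c * f x) = cmod c * nrm f"
  unfolding nrm_def by (simp add: norm_mult power_mult_distrib real_sqrt_mult)

lemma sqint_add:
  assumes "sqint f" "sqint g"
  shows "sqint (\<lambda>x. f x + g x)"
proof -
  have "integrable lborel (\<lambda>x. (cmod (f x + g x))\<^sup>2)"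
  proof (rule Bochner_Integration.integrable_bound)
    show "integrable lborel
        (\<lambda>x. (cmod (f x))\<^sup>2 + 2 * (cmod (f x) * cmod (g x)) + (cmod (g x))\<^sup>2)"
      using assms by (intro Bochner_Integration.integrable_add sqint_integrable
          integrable_mult_right integrable_cmod_prod)
    show "(\<lambda>x. (cmod (f x + g x))\<^sup>2) \<in> borel_measurable lborel"
      using assms[THEN sqint_measurable] by measurable
    have "(cmod (u + v))\<^sup>2 \<le> (cmod u)\<^sup>2 + 2 * (cmod u * cmod v) + (cmod v)\<^sup>2" for u v
      using power_mono[OF norm_triangle_ineq[of u v], of 2] by (simp add: power2_sum)
    then show "AE x in lborel. norm ((cmod (f x + g x))\<^sup>2)
        \<le> norm ((cmod (f x))\<^sup>2 + 2 * (cmod (f x) * cmod (g x)) + (cmod (g x))\<^sup>2)"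
      by auto
  qed
  then show ?thesis using assms[THEN sqint_measurable] unfolding sqint_def by auto
qed

lemma sqint_zero: "sqint (\<lambda>x. 0)"
  unfolding sqint_def by simp

lemma sqint_diff:
  assumes "sqint f" "sqint g"
  shows "sqint (\<lambda>x. f x - g x)"
  using sqint_add[OF assms(1) sqint_scale[OF assms(2), of "-1"]] by simp

lemma sqint_sum:
  assumes "\<And>i. i \<in> F \<Longrightarrow> sqint (f i)"
  shows "sqint (\<lambda>x. \<Sum>i\<in>F. f i x)"
  using assms by (induction F rule: infinite_finite_induct) (auto intro: sqint_add sqint_zero)

lemma sqint_indicator:
  assumes "I \<in> dyadic_intervals"
  shows "sqint (indicator I)"
proof -
  have "(\<lambda>x. (cmod (indicator I x))\<^sup>2) = (indicator I :: real \<Rightarrow> real)"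
    by (auto simp: indicator_def)
  moreover have "integrable lborel (indicator I :: real \<Rightarrow> real)"
    using assms dyadic_emeasure[OF assms] by (intro integrable_real_indicator) auto
  ultimately show ?thesis
    using assms unfolding sqint_def by auto
qed

lemma sqint_mult_indicator:
  assumes "sqint f" "I \<in> dyadic_intervals"
  shows "sqint (\<lambda>x. f x * indicator I x)"
proof -
  have m: "(\<lambda>x. f x * indicator I x) \<in> borel_measurable lborel"
    using assms sqint_measurable[OF assms(1)] by auto
  have "integrable lborel (\<lambda>x. (cmod (f x * indicator I x))\<^sup>2)"
  proof (rule Bochner_Integration.integrable_bound[OF sqint_integrable[OF assms(1)]])
    show "(\<lambda>x. (cmod (f x * indicator I x))\<^sup>2) \<in> borel_measurable lborel"
      using m by measurable
  qed (auto simp: indicator_def)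
  with m show ?thesis unfolding sqint_def by auto
qed

section \<open>Cauchy-Schwarz and triangle inequality\<close>

text \<open>Integrate \<open>2 u v \<le> t u^2 + v^2 / t\<close> and choose \<open>t\<close> as the
  ratio of the norms of \<open>g\<close> and \<open>f\<close>.\<close>

lemma cauchy_schwarz_real:
  assumes "sqint f" "sqint g"
  shows "(LINT x|lborel. cmod (f x) * cmod (g x)) \<le> nrm f * nrm g"
proof -
  let ?C = "LINT x|lborel. cmod (f x) * cmod (g x)"
  have *: "2 * ?C \<le> t * (nrm f)\<^sup>2 + (nrm g)\<^sup>2 / t" if "t > 0" for t
  proof -
    have "(LINT x|lborel. 2 * (cmod (f x) * cmod (g x)))
        \<le> (LINT x|lborel. t * (cmod (f x))\<^sup>2 + (cmod (g x))\<^sup>2 / t)"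
    proof (rule integral_mono)
      show "2 * (u * v) \<le> t * u\<^sup>2 + v\<^sup>2 / t" for u v :: real
      proof -
        have "0 \<le> (t * u - v)\<^sup>2 / t" using that by simp
        also have "\<dots> = t * u\<^sup>2 + v\<^sup>2 / t - 2 * (u * v)"
          using that by (simp add: power2_eq_square field_simps)
        finally show ?thesis by simp
      qed
    qed (use assms that in \<open>auto intro!: Bochner_Integration.integrable_add
        integrable_mult_right integrable_divide sqint_integrable integrable_cmod_prod\<close>)
    then show ?thesis
      using assms that by (simp add: nrm_sq sqint_integrable)
  qed
  define p q where "p = nrm f" and "q = nrm g"
  have pq: "p \<ge> 0" "q \<ge> 0" by (simp_all add: p_def q_def)
  \<comment> \<open>The optimal ratio \<open>t = q / p\<close> needs positive norms, so both are
    enlarged by \<open>d > 0\<close>, which tends to \<open>0\<close> afterwards.\<close>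
  have "?C \<le> (p + d) * (q + d)" if "d > 0" for d
  proof -
    define P Q where "P = p + d" and "Q = q + d"
    have PQ: "P > 0" "Q > 0" "p\<^sup>2 \<le> P\<^sup>2" "q\<^sup>2 \<le> Q\<^sup>2"
      using pq that by (auto simp: P_def Q_def intro!: power_mono)
    have "2 * ?C \<le> (Q / P) * p\<^sup>2 + q\<^sup>2 / (Q / P)"
      using *[of "Q / P"] PQ by (simp add: p_def q_def)
    also have "\<dots> \<le> (Q / P) * P\<^sup>2 + Q\<^sup>2 / (Q / P)"
      using PQ by (intro add_mono mult_left_mono divide_right_mono) auto
    also have "\<dots> = 2 * (P * Q)" using PQ by (simp add: power2_eq_square)
    finally show ?thesis by (simp add: P_def Q_def)
  qed
  then have "\<forall>\<^sub>F d in at_right 0. ?C \<le> (p + d) * (q + d)"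
    by (rule eventually_mono[OF eventually_at_right_less])
  moreover have "((\<lambda>d. (p + d) * (q + d)) \<longlongrightarrow> (p + 0) * (q + 0)) (at_right 0)"
    by (intro tendsto_intros)
  ultimately have "?C \<le> (p + 0) * (q + 0)"
    by (intro tendsto_lowerbound) auto
  then show ?thesis by (simp add: p_def q_def)
qed

lemma cauchy_schwarz_integral:
  assumes "sqint f" "sqint g"
  shows "cmod (LINT x|lborel. f x * g x) \<le> nrm f * nrm g"
proof -
  have "cmod (LINT x|lborel. f x * g x) \<le> (LINT x|lborel. cmod (f x * g x))"
    by (rule integral_norm_bound)
  with cauchy_schwarz_real[OF assms] show ?thesis by (simp add: norm_mult)
qed

lemma nrm_triangle:
  assumes "sqint f" "sqint g"
  shows "nrm (\<lambda>x. f x + g x) \<le> nrm f + nrm g"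
proof -
  have "(LINT x|lborel. (cmod (f x + g x))\<^sup>2)
      \<le> (LINT x|lborel. (cmod (f x))\<^sup>2 + 2 * (cmod (f x) * cmod (g x)) + (cmod (g x))\<^sup>2)"
  proof (rule integral_mono)
    show "(cmod (u + v))\<^sup>2 \<le> (cmod u)\<^sup>2 + 2 * (cmod u * cmod v) + (cmod v)\<^sup>2" for u v
      using power_mono[OF norm_triangle_ineq[of u v], of 2] by (simp add: power2_sum)
  qed (use assms in \<open>auto intro!: Bochner_Integration.integrable_add
      integrable_mult_right sqint_integrable integrable_cmod_prod sqint_add\<close>)
  also have "\<dots> = (nrm f)\<^sup>2 + 2 * (LINT x|lborel. cmod (f x) * cmod (g x)) + (nrm g)\<^sup>2"
    using assms by (simp add: nrm_sq sqint_integrable integrable_cmod_prod)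
  also have "\<dots> \<le> (nrm f + nrm g)\<^sup>2"
    using cauchy_schwarz_real[OF assms] by (simp add: power2_sum)
  finally have "(nrm (\<lambda>x. f x + g x))\<^sup>2 \<le> (nrm f + nrm g)\<^sup>2" by (simp add: nrm_sq)
  then show ?thesis by (rule power2_le_imp_le) simp
qed

lemma L2_norm_eq:
  assumes "sqint f"
  shows "L2_norm f = ennreal (nrm f)"
proof -
  have "(\<integral>\<^sup>+ x. ennreal ((cmod (f x))\<^sup>2) \<partial>lborel) = ennreal ((nrm f)\<^sup>2)"
    unfolding nrm_sq by (rule nn_integral_eq_integral[OF sqint_integrable[OF assms]]) simp
  then show ?thesis unfolding L2_norm_def ennsqrt_def by simp
qed

lemma nrm_le_add_diff:
  assumes "sqint f" "sqint g"
  shows "nrm g \<le> nrm f + nrm (\<lambda>x. f x - g x)"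
  using nrm_triangle[OF assms(1) sqint_scale[OF sqint_diff[OF assms], of "- 1"]]
    nrm_scale[of "- 1" "\<lambda>x. f x - g x"] by simp


section \<open>Haar functions and averages\<close>

declare One_nat_def [simp del]

lemma haar_1_eq: "haar 1 I = (\<lambda>x. of_real (1 / len I) * indicator I x)"
  unfolding haar_def by simp

lemma haar_0_eq:
  "haar 0 I = (\<lambda>x. of_real (1 / sqrt (len I)) *
     (of_real (- 1) * indicator (left_half I) x + indicator (right_half I) x))"
  unfolding haar_def by simp

lemma cnj_haar [simp]: "cnj (haar \<alpha> I x) = haar \<alpha> I x"
  unfolding haar_def by (simp add: indicator_def)

lemma sqint_haar_1: "I \<in> dyadic_intervals \<Longrightarrow> sqint (haar 1 I)"
  unfolding haar_1_eq by (intro sqint_scale sqint_indicator)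

lemma sqint_haar_0: "I \<in> dyadic_intervals \<Longrightarrow> sqint (haar 0 I)"
  unfolding haar_0_eq by (intro sqint_scale sqint_add sqint_indicator half_in)

lemma L2_inner_haar: "L2_inner f (haar \<alpha> I) = (LINT x|lborel. f x * haar \<alpha> I x)"
  unfolding L2_inner_def by simp

lemma L2_inner_sum:
  assumes "\<And>i. i \<in> F \<Longrightarrow> sqint (f i)" "sqint g"
  shows "L2_inner (\<lambda>x. \<Sum>i\<in>F. c i * f i x) g = (\<Sum>i\<in>F. c i * L2_inner (f i) g)"
proof -
  have "(LINT x|lborel. (\<Sum>i\<in>F. c i * f i x) * cnj (g x))
      = (LINT x|lborel. (\<Sum>i\<in>F. c i * (f i x * cnj (g x))))"
    by (simp add: sum_distrib_right mult.assoc)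
  also have "\<dots> = (\<Sum>i\<in>F. LINT x|lborel. c i * (f i x * cnj (g x)))"
    using assms by (intro Bochner_Integration.integral_sum integrable_mult_right
        integrable_prod sqint_cnj)
  finally show ?thesis unfolding L2_inner_def by simp
qed

lemma cnj_L2_inner: "cnj (L2_inner f g) = L2_inner g f"
proof -
  have "L2_inner g f = (LINT x|lborel. cnj (f x * cnj (g x)))"
    unfolding L2_inner_def by (simp add: mult.commute)
  also have "\<dots> = cnj (L2_inner f g)"
    unfolding L2_inner_def by (rule Bochner_Integration.integral_cnj)
  finally show ?thesis by simp
qed

lemma L2_inner_self: "sqint f \<Longrightarrow> L2_inner f f = of_real ((nrm f)\<^sup>2)"
  unfolding L2_inner_def nrm_sq
  by (simp add: complex_norm_square[symmetric] integral_complex_of_real[symmetric]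
      del: integral_complex_of_real of_real_power)

lemma integral_indicator_complex:
  assumes "I \<in> dyadic_intervals"
  shows "(LINT x|lborel. indicator I x :: complex) = of_real (len I)"
proof -
  have "(\<lambda>x. indicator I x :: complex) = (\<lambda>x. of_real (indicator I x))"
    by (auto simp: indicator_def)
  then show ?thesis
    using assms by (simp add: integral_complex_of_real)
qed

section \<open>Averages of Haar functions over dyadic intervals\<close>

text \<open>A Haar function is constant on every dyadic interval that lies inside one of its halves
  or misses its support, so its averages there are read off from its values.\<close>

lemma average_haar_const:
  assumes "K \<in> dyadic_intervals" "\<And>x. x \<in> K \<Longrightarrow> f x = c"
  shows "L2_inner f (haar 1 K) = c"
proof -
  have "(\<lambda>x. f x * haar 1 K x) = (\<lambda>x. c * of_real (1 / len K) * indicator K x)"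
    using assms(2) by (auto simp: haar_1_eq indicator_def)
  then show ?thesis
    unfolding L2_inner_haar
    using integral_indicator_complex[OF assms(1)] len_pos[OF assms(1)] by simp
qed

lemma average_haar_left:
  assumes "K \<in> dyadic_intervals" "K \<subseteq> left_half J"
  shows "L2_inner (haar 0 J) (haar 1 K) = - of_real (1 / sqrt (len J))"
  using assms halves_disjoint[of J]
  by (intro average_haar_const) (auto simp: haar_0_eq indicator_def)

lemma average_haar_right:
  assumes "K \<in> dyadic_intervals" "K \<subseteq> right_half J"
  shows "L2_inner (haar 0 J) (haar 1 K) = of_real (1 / sqrt (len J))"
  using assms halves_disjoint[of J]
  by (intro average_haar_const) (auto simp: haar_0_eq indicator_def)

lemma average_haar_disjoint:
  assumes "K \<in> dyadic_intervals" "J \<inter> K = {}"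
  shows "L2_inner (haar 0 J) (haar 1 K) = 0"
  using assms halves_Un[of J]
  by (intro average_haar_const) (auto simp: haar_0_eq indicator_def)

text \<open>The halves of \<open>J\<close> have equal length, so the positive and negative parts of
  the Haar function cancel inside \<open>K\<close>.\<close>

lemma average_haar_superset:
  assumes "J \<in> dyadic_intervals" "J \<subseteq> K"
  shows "L2_inner (haar 0 J) (haar 1 K) = 0"
proof -
  have eq: "(\<lambda>x. haar 0 J x * haar 1 K x) = (\<lambda>x. of_real (1 / sqrt (len J) * (1 / len K)) *
      (indicator (right_half J) x - indicator (left_half J) x))"
    using halves_Un[of J] assms(2) by (auto simp: haar_0_eq haar_1_eq indicator_def fun_eq_iff)
  have int: "integrable lborel (\<lambda>x. indicator I x :: complex)" if "I \<in> dyadic_intervals" for I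
    using integrable_prod[OF sqint_indicator[OF that] sqint_indicator[OF that]]
    by (simp flip: indicator_inter_arith)
  show ?thesis
    unfolding L2_inner_haar eq
    using half_in[OF assms(1)] len_half[OF assms(1)]
    by (simp add: integral_indicator_complex int)
qed

lemma L2_inner_haar_1:
  "L2_inner f (haar 1 I) = of_real (1 / len I) * (LINT x|lborel. f x * indicator I x)"
proof -
  have "(\<lambda>x. f x * haar 1 I x) = (\<lambda>x. of_real (1 / len I) * (f x * indicator I x))"
    by (simp add: haar_1_eq fun_eq_iff)
  then show ?thesis
    unfolding L2_inner_haar by (simp only: integral_mult_right_zero)
qed

lemma integrable_on_dyadic:
  assumes "sqint f" "I \<in> dyadic_intervals"
  shows "integrable lborel (\<lambda>x. f x * indicator I x)"
  using assms by (intro integrable_prod sqint_indicator)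

lemma average_halves:
  assumes "sqint f" "I \<in> dyadic_intervals"
  shows "L2_inner f (haar 1 I)
    = (L2_inner f (haar 1 (left_half I)) + L2_inner f (haar 1 (right_half I))) / 2"
proof -
  have "(\<lambda>x. f x * indicator I x)
      = (\<lambda>x. f x * indicator (left_half I) x + f x * indicator (right_half I) x)"
    using halves_Un[of I] halves_disjoint[of I] by (auto simp: indicator_def fun_eq_iff)
  then have "(LINT x|lborel. f x * indicator I x)
      = (LINT x|lborel. f x * indicator (left_half I) x) + (LINT x|lborel. f x * indicator (right_half I) x)"
    using integrable_on_dyadic[OF assms(1)] half_in[OF assms(2)] by simp
  then show ?thesis
    using len_pos[OF assms(2)]
    unfolding L2_inner_haar_1 len_half[OF assms(2)] by (simp add: field_simps)
qed

text \<open>Haar coefficients are differences of averages, which reduces orthogonality to the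
  averages computed above.\<close>

lemma L2_inner_haar_0:
  assumes "sqint f" "I \<in> dyadic_intervals"
  shows "L2_inner f (haar 0 I) = of_real (sqrt (len I) / 2) *
    (L2_inner f (haar 1 (right_half I)) - L2_inner f (haar 1 (left_half I)))"
proof -
  have "(\<lambda>x. f x * haar 0 I x) = (\<lambda>x. of_real (1 / sqrt (len I)) *
      (f x * indicator (right_half I) x - f x * indicator (left_half I) x))"
    by (simp add: haar_0_eq fun_eq_iff algebra_simps)
  then have *: "L2_inner f (haar 0 I) = of_real (1 / sqrt (len I)) *
      ((LINT x|lborel. f x * indicator (right_half I) x)
        - (LINT x|lborel. f x * indicator (left_half I) x))"
    unfolding L2_inner_haar
    using integrable_on_dyadic[OF assms(1)] half_in[OF assms(2)] by simp
  \<comment> \<open>Each half has length \<open>|I| / 2\<close>, which turns the normalisation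
    \<open>|I|^(-1/2)\<close> into \<open>sqrt |I| / 2\<close>.\<close>
  have "1 / sqrt (len I) = sqrt (len I) / 2 * (1 / (len I / 2))"
    using len_pos[OF assms(2)] real_sqrt_mult_self[of "len I"] by (simp add: field_simps)
  then have "(of_real (1 / sqrt (len I)) :: complex)
      = of_real (sqrt (len I) / 2) * of_real (1 / (len I / 2))"
    by (metis of_real_mult)
  then show ?thesis
    unfolding L2_inner_haar_1 len_half[OF assms(2)] * by (simp only: right_diff_distrib mult.assoc)
qed

section \<open>Orthonormality and Parseval's identity\<close>

text \<open>Off the diagonal the averages of \<open>haar 0 J\<close> over the two halves of
  \<open>I\<close> agree: either \<open>I\<close> lies where \<open>haar 0 J\<close> is constant, or
  \<open>J\<close> lies in one half of \<open>I\<close> and both averages vanish.\<close>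

lemma haar_orthonormal:
  assumes "I \<in> dyadic_intervals" "J \<in> dyadic_intervals"
  shows "L2_inner (haar 0 J) (haar 0 I) = (if I = J then 1 else 0)"
proof (cases "I = J")
  case True
  then show ?thesis
    using assms half_in[OF assms(1)] len_pos[OF assms(2)]
    by (simp add: L2_inner_haar_0 sqint_haar_0 average_haar_left average_haar_right)
next
  case False
  note halves = half_in[OF assms(1)]
  have "L2_inner (haar 0 J) (haar 1 (right_half I)) = L2_inner (haar 0 J) (haar 1 (left_half I))"
  proof -
    consider "I \<inter> J = {}" | "I \<subseteq> left_half J" | "I \<subseteq> right_half J"
      | "J \<subseteq> left_half I" | "J \<subseteq> right_half I"
      using dyadic_nested[OF assms] dyadic_subset_cases[OF assms]
        dyadic_subset_cases[OF assms(2,1)] False by blast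
    then show ?thesis
    proof cases
      case 1
      then have "J \<inter> left_half I = {}" "J \<inter> right_half I = {}"
        using halves_Un[of I] by blast+
      then show ?thesis using halves by (simp add: average_haar_disjoint)
    next
      case 2
      then have "left_half I \<subseteq> left_half J" "right_half I \<subseteq> left_half J"
        using halves_Un[of I] by blast+
      then show ?thesis using halves by (simp add: average_haar_left)
    next
      case 3
      then have "left_half I \<subseteq> right_half J" "right_half I \<subseteq> right_half J"
        using halves_Un[of I] by blast+
      then show ?thesis using halves by (simp add: average_haar_right)
    next
      case 4
      then have "J \<inter> right_half I = {}" using halves_disjoint[of I] by blast
      then show ?thesis
        using halves 4 assms by (simp add: average_haar_disjoint average_haar_superset)
    next
      case 5
      then have "J \<inter> left_half I = {}" using halves_disjoint[of I] by blast
      then show ?thesis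
        using halves 5 assms by (simp add: average_haar_disjoint average_haar_superset)
    qed
  qed
  then show ?thesis
    using False assms by (simp add: L2_inner_haar_0 sqint_haar_0)
qed

lemma sqint_haar_sum:
  assumes "F \<subseteq> dyadic_intervals"
  shows "sqint (\<lambda>x. \<Sum>I\<in>F. c I * haar 0 I x)"
  using assms by (intro sqint_sum sqint_scale sqint_haar_0) auto

lemma haar_coefficient:
  assumes "finite F" "F \<subseteq> dyadic_intervals" "J \<in> dyadic_intervals"
  shows "L2_inner (\<lambda>x. \<Sum>I\<in>F. c I * haar 0 I x) (haar 0 J) = (if J \<in> F then c J else 0)"
proof -
  have "L2_inner (\<lambda>x. \<Sum>I\<in>F. c I * haar 0 I x) (haar 0 J)
      = (\<Sum>I\<in>F. c I * L2_inner (haar 0 I) (haar 0 J))"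
    using assms by (intro L2_inner_sum sqint_haar_0) auto
  also have "\<dots> = (\<Sum>I\<in>F. if J = I then c I else 0)"
  proof (rule sum.cong[OF refl])
    fix I assume "I \<in> F"
    then have "I \<in> dyadic_intervals" using assms by auto
    then show "c I * L2_inner (haar 0 I) (haar 0 J) = (if J = I then c I else 0)"
      using assms by (simp add: haar_orthonormal)
  qed
  finally show ?thesis using assms(1) by simp
qed

text \<open>Parseval's identity for finite sums: expanding only the first argument of the inner
  product leaves Haar coefficients, known from \<open>haar_coefficient\<close>.\<close>

lemma nrm_haar_sum:
  assumes "finite F" "F \<subseteq> dyadic_intervals"
  shows "(nrm (\<lambda>x. \<Sum>I\<in>F. c I * haar 0 I x))\<^sup>2 = (\<Sum>I\<in>F. (cmod (c I))\<^sup>2)"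
proof -
  let ?f = "\<lambda>x. \<Sum>I\<in>F. c I * haar 0 I x"
  have "of_real ((nrm ?f)\<^sup>2) = L2_inner ?f ?f"
    using L2_inner_self[OF sqint_haar_sum[OF assms(2), of c]] ..
  also have "\<dots> = (\<Sum>I\<in>F. c I * L2_inner (haar 0 I) ?f)"
    using assms by (intro L2_inner_sum sqint_haar_sum sqint_haar_0) auto
  also have "\<dots> = (\<Sum>I\<in>F. c I * cnj (c I))"
    using assms
    by (intro sum.cong refl) (subst cnj_L2_inner[symmetric], subst haar_coefficient, auto)
  also have "\<dots> = of_real (\<Sum>I\<in>F. (cmod (c I))\<^sup>2)"
    by (simp only: complex_norm_square of_real_sum)
  finally show ?thesis by (simp only: of_real_eq_iff)
qed

lemma nrm_haar_0: "I \<in> dyadic_intervals \<Longrightarrow> nrm (haar 0 I) = 1"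
  using nrm_haar_sum[of "{I}" "\<lambda>_. 1"] nrm_nonneg[of "haar 0 I"] by (auto simp: power2_eq_1_iff)

lemma haar_span_sqint: "f \<in> haar_span \<Longrightarrow> sqint f"
  unfolding haar_span_def using sqint_haar_sum by auto


section \<open>The dyadic Carleson embedding theorem\<close>

text \<open>The truncated function is kept inside \<open>nrm\<close> so that Cauchy-Schwarz applies
  to it directly; \<open>local_energy_eq\<close> is the form that is visibly additive over
  halves.\<close>

definition local_energy :: "(real \<Rightarrow> complex) \<Rightarrow> real set \<Rightarrow> real" where
  "local_energy f I = (nrm (\<lambda>x. f x * indicator I x))\<^sup>2"

lemma local_energy_eq: "local_energy f I = (LINT x|lborel. (cmod (f x))\<^sup>2 * indicator I x)"
  unfolding local_energy_def nrm_sq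
  by (intro Bochner_Integration.integral_cong) (auto simp: indicator_def)

lemma integrable_local_energy:
  assumes "sqint f" "I \<in> dyadic_intervals"
  shows "integrable lborel (\<lambda>x. (cmod (f x))\<^sup>2 * indicator I x)"
proof -
  have "(\<lambda>x. (cmod (f x * indicator I x))\<^sup>2) = (\<lambda>x. (cmod (f x))\<^sup>2 * indicator I x)"
    by (auto simp: indicator_def)
  with sqint_integrable[OF sqint_mult_indicator[OF assms]] show ?thesis by simp
qed

lemma local_energy_halves:
  assumes "sqint f" "I \<in> dyadic_intervals"
  shows "local_energy f I = local_energy f (left_half I) + local_energy f (right_half I)"
proof -
  have "(\<lambda>x. (cmod (f x))\<^sup>2 * indicator I x) = (\<lambda>x. (cmod (f x))\<^sup>2 * indicator (left_half I) x
      + (cmod (f x))\<^sup>2 * indicator (right_half I) x)"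
    using halves_Un[of I] halves_disjoint[of I] by (auto simp: indicator_def fun_eq_iff)
  then show ?thesis
    using integrable_local_energy[OF assms(1)] half_in[OF assms(2)]
    by (simp add: local_energy_eq)
qed

text \<open>Disjointness makes the indicators sum to at most \<open>1\<close> at every
  point.\<close>

lemma sum_local_energy_le:
  assumes "sqint f" "finite T" "T \<subseteq> dyadic_intervals" "disjoint T"
  shows "(\<Sum>I\<in>T. local_energy f I) \<le> (nrm f)\<^sup>2"
proof -
  have int: "integrable lborel (\<lambda>x. (cmod (f x))\<^sup>2 * indicator I x)" if "I \<in> T" for I
    using integrable_local_energy[OF assms(1)] that assms(3) by auto
  have "(\<Sum>I\<in>T. local_energy f I) = (LINT x|lborel. (\<Sum>I\<in>T. (cmod (f x))\<^sup>2 * indicator I x))"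
    using int by (simp add: local_energy_eq)
  also have "\<dots> \<le> (LINT x|lborel. (cmod (f x))\<^sup>2)"
  proof (rule integral_mono)
    fix x
    have "indicator (\<Union>I\<in>T. I) x = (\<Sum>I\<in>T. indicator I x :: real)"
      using assms(4) by (intro indicator_UN_disjoint[OF assms(2)])
        (auto simp: disjoint_def disjoint_family_on_def)
    then have "(\<Sum>I\<in>T. indicator I x) \<le> (1 :: real)"
      by (metis indicator_le_1)
    then show "(\<Sum>I\<in>T. (cmod (f x))\<^sup>2 * indicator I x) \<le> (cmod (f x))\<^sup>2"
      unfolding sum_distrib_left[symmetric] by (intro mult_left_le) auto
  qed (use int sqint_integrable[OF assms(1)] in auto)
  finally show ?thesis by (simp add: nrm_sq)
qed

text \<open>Cauchy-Schwarz for the truncation of \<open>f\<close> to \<open>I\<close> against the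
  indicator of \<open>I\<close>, whose squared norm is \<open>|I|\<close>.\<close>

lemma average_sq_le_local_energy:
  assumes "sqint f" "I \<in> dyadic_intervals"
  shows "len I * (cmod (L2_inner f (haar 1 I)))\<^sup>2 \<le> local_energy f I"
proof -
  have L: "len I > 0" using len_pos[OF assms(2)] .
  have n: "(nrm (indicator I))\<^sup>2 = len I"
  proof -
    have "(\<lambda>x. (cmod (indicator I x))\<^sup>2) = (indicator I :: real \<Rightarrow> real)"
      by (auto simp: indicator_def)
    then show ?thesis using assms(2) by (simp add: nrm_sq)
  qed
  have "cmod (LINT x|lborel. (f x * indicator I x) * indicator I x)
      \<le> nrm (\<lambda>x. f x * indicator I x) * nrm (indicator I)"
    using assms by (intro cauchy_schwarz_integral sqint_mult_indicator sqint_indicator)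
  moreover have "(\<lambda>x. (f x * indicator I x) * indicator I x) = (\<lambda>x. f x * indicator I x)"
    by (auto simp: indicator_def)
  ultimately have "(cmod (LINT x|lborel. f x * indicator I x))\<^sup>2 \<le> local_energy f I * len I"
    using power_mono[of "cmod (LINT x|lborel. f x * indicator I x)"
        "nrm (\<lambda>x. f x * indicator I x) * nrm (indicator I)" 2]
    by (simp add: local_energy_def power_mult_distrib n)
  then show ?thesis
    using L by (simp add: L2_inner_haar_1 norm_mult norm_divide power_divide power2_eq_square field_simps)
qed

section \<open>The Bellman function argument\<close>

text \<open>One step from \<open>I\<close> to its halves. Here \<open>p\<close> and \<open>q\<close>
  are \<open>M\<close> plus the Carleson averages of the halves, \<open>a\<close> is the
  contribution of \<open>I\<close> itself, and \<open>x\<close>, \<open>y\<close>, \<open>z\<close>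
  are the moduli of the averages of \<open>f\<close> over \<open>I\<close> and its halves. The
  denominator \<open>(p + q) / 2 + a\<close> is then \<open>M + A_I\<close>, and everything is
  scaled by \<open>4 M^2\<close>.\<close>

lemma bellman_inequality:
  fixes x y z p q a M :: real
  assumes pq: "p > 0" "q > 0" and a: "a \<ge> 0" and M: "(p + q) / 2 + a \<le> 2 * M"
    and x: "0 \<le> x" "x \<le> (y + z) / 2"
  shows "a * x\<^sup>2 + 4 * M\<^sup>2 * x\<^sup>2 / ((p + q) / 2 + a) \<le> 2 * M\<^sup>2 * (y\<^sup>2 / p + z\<^sup>2 / q)"
proof -
  define m A where "m = (p + q) / 2" and "A = m + a"
  have m: "m > 0" "m \<le> A" "A > 0" "A \<le> 2 * M"
    using pq a M by (auto simp: m_def A_def intro: add_pos_nonneg)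
  \<comment> \<open>Midpoint convexity of \<open>x^2 / m\<close> in both variables; the defect is a
    square over a positive number.\<close>
  have convex: "x\<^sup>2 / m \<le> (y\<^sup>2 / p + z\<^sup>2 / q) / 2"
  proof -
    have "x\<^sup>2 / m \<le> ((y + z) / 2)\<^sup>2 / m"
      using x m by (intro divide_right_mono power_mono) auto
    also have "\<dots> = (y + z)\<^sup>2 / (p + q) / 2"
      using pq by (simp add: m_def power_divide field_simps)
    also have "(y + z)\<^sup>2 / (p + q) \<le> y\<^sup>2 / p + z\<^sup>2 / q"
    proof -
      have "y\<^sup>2 / p + z\<^sup>2 / q - (y + z)\<^sup>2 / (p + q) = (q * y - p * z)\<^sup>2 / (p * q * (p + q))"
        using pq by (simp add: field_simps power2_eq_square)
      also have "\<dots> \<ge> 0" using pq by simp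
      finally show ?thesis by simp
    qed
    finally show ?thesis by simp
  qed
  \<comment> \<open>Decrease in the second variable: passing from \<open>m\<close> to
    \<open>A = m + a\<close> lowers \<open>x^2 / m\<close> by \<open>a x^2 / (m A)\<close>, and both
    \<open>m\<close> and \<open>A\<close> are at most \<open>2 M\<close>.\<close>
  have "m * A \<le> (2 * M) * (2 * M)"
    using m by (intro mult_mono) auto
  then have "a * x\<^sup>2 * (m * A) \<le> a * x\<^sup>2 * (4 * M\<^sup>2)"
    using a by (intro mult_left_mono) (auto simp: power2_eq_square)
  then have "a * x\<^sup>2 \<le> 4 * M\<^sup>2 * (a * x\<^sup>2 / (m * A))"
    using m by (simp add: field_simps)
  also have "a * x\<^sup>2 / (m * A) = x\<^sup>2 / m - x\<^sup>2 / A"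
    using m by (simp add: A_def field_simps)
  finally have "a * x\<^sup>2 + 4 * M\<^sup>2 * x\<^sup>2 / A \<le> 4 * M\<^sup>2 * (x\<^sup>2 / m)"
    by (simp add: algebra_simps)
  also have "\<dots> \<le> 4 * M\<^sup>2 * ((y\<^sup>2 / p + z\<^sup>2 / q) / 2)"
    using convex by (intro mult_left_mono) auto
  finally show ?thesis by (simp add: A_def m_def algebra_simps)
qed

lemma sum_below_halves:
  fixes w :: "real set \<Rightarrow> real"
  assumes "finite G" "G \<subseteq> dyadic_intervals" "I \<in> dyadic_intervals"
  shows "(\<Sum>J\<in>{J\<in>G. J \<subseteq> I}. w J) = (if I \<in> G then w I else 0)
    + (\<Sum>J\<in>{J\<in>G. J \<subseteq> left_half I}. w J) + (\<Sum>J\<in>{J\<in>G. J \<subseteq> right_half I}. w J)"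
proof -
  have split: "{J\<in>G. J \<subseteq> I} = ({I} \<inter> G) \<union> ({J\<in>G. J \<subseteq> left_half I} \<union> {J\<in>G. J \<subseteq> right_half I})"
    using dyadic_subset_cases[OF assms(3)] assms(2) halves_Un[of I] by blast
  \<comment> \<open>A common member would be a subset of two disjoint halves, hence empty.\<close>
  have "{J\<in>G. J \<subseteq> left_half I} \<inter> {J\<in>G. J \<subseteq> right_half I} = {}"
    using halves_disjoint[of I] dyadic_emptyI assms(2) by blast
  moreover have "({I} \<inter> G) \<inter> ({J\<in>G. J \<subseteq> left_half I} \<union> {J\<in>G. J \<subseteq> right_half I}) = {}"
    using half_not_superset[OF assms(3)] by blast
  ultimately show ?thesis
    unfolding split using assms(1) by (simp add: sum.union_disjoint)
qed

text \<open>\<open>w J\<close> stands for \<open>|a_J|^2\<close>. The induction is on the number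
  \<open>n\<close> of generations, counted from \<open>I\<close> downwards, that can contain members
  of \<open>G\<close>. The subtracted term is \<open>4 M^2 |I|\<close> times the Bellman function at
  \<open>I\<close>; it is what makes the gains of successive generations telescope.\<close>

lemma carleson_local:
  fixes w :: "real set \<Rightarrow> real"
  assumes f: "sqint f" and G: "finite G" "G \<subseteq> dyadic_intervals"
    and w: "\<And>J. 0 \<le> w J" and M: "M > 0"
    and carleson: "\<And>I. I \<in> dyadic_intervals \<Longrightarrow> (\<Sum>J\<in>{J\<in>G. J \<subseteq> I}. w J) \<le> M * len I"
    and I: "I \<in> dyadic_intervals" "\<And>J. J \<in> G \<Longrightarrow> J \<subseteq> I \<Longrightarrow> len I < 2 ^ n * len J"
  shows "(\<Sum>J\<in>{J\<in>G. J \<subseteq> I}. w J * (cmod (L2_inner f (haar 1 J)))\<^sup>2)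
    \<le> 4 * M * local_energy f I - 4 * M\<^sup>2 * (len I * (cmod (L2_inner f (haar 1 I)))\<^sup>2) /
        (M + (\<Sum>J\<in>{J\<in>G. J \<subseteq> I}. w J) / len I)"
  using I
proof (induction n arbitrary: I)
  case 0
  let ?S = "\<Sum>J\<in>{J\<in>G. J \<subseteq> I}. w J"
  have L: "len I > 0" using len_pos[OF 0(1)] .
  \<comment> \<open>For \<open>n = 0\<close> a member of \<open>G\<close> below \<open>I\<close>
    would be longer than \<open>I\<close>. Both sums vanish and only Cauchy-Schwarz on
    \<open>I\<close> remains.\<close>
  have "{J\<in>G. J \<subseteq> I} = {}"
    using 0 len_mono[OF 0(1)] G by force
  then have "(\<Sum>J\<in>{J\<in>G. J \<subseteq> I}. w J * (cmod (L2_inner f (haar 1 J)))\<^sup>2) = 0" "?S = 0"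
    by (simp_all only: sum.empty)
  moreover have "4 * M * (len I * (cmod (L2_inner f (haar 1 I)))\<^sup>2) \<le> 4 * M * local_energy f I"
    using average_sq_le_local_energy[OF f 0(1)] M by (intro mult_left_mono) auto
  ultimately show ?case
    using M by (simp add: power2_eq_square)
next
  case (Suc n)
  let ?l = "left_half I" and ?r = "right_half I"
  let ?S = "\<lambda>I. \<Sum>J\<in>{J\<in>G. J \<subseteq> I}. w J"
  let ?Q = "\<lambda>I. \<Sum>J\<in>{J\<in>G. J \<subseteq> I}. w J * (cmod (L2_inner f (haar 1 J)))\<^sup>2"
  let ?x = "\<lambda>I. cmod (L2_inner f (haar 1 I))"
  let ?A = "\<lambda>I. M + ?S I / len I"
  \<comment> \<open>The share of \<open>I\<close> itself in its Carleson average, so that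
    \<open>?A I\<close> is the mean of \<open>?A\<close> over the halves plus
    \<open>a\<close>.\<close>
  define a where "a = (if I \<in> G then w I else 0) / len I"
  have L: "len I > 0" using len_pos[OF Suc.prems(1)] .
  note halves = half_in[OF Suc.prems(1)] and lens = len_half[OF Suc.prems(1)]
  have sub: "?l \<subseteq> I" "?r \<subseteq> I" using halves_Un[of I] by auto
  have IH: "?Q K \<le> 4 * M * local_energy f K - 4 * M\<^sup>2 * (len K * (?x K)\<^sup>2) / ?A K"
    if "K = ?l \<or> K = ?r" for K
  proof (rule Suc.IH)
    show "K \<in> dyadic_intervals" using that halves by auto
    fix J assume "J \<in> G" "J \<subseteq> K"
    \<comment> \<open>Passing to a half uses up one factor \<open>2\<close>.\<close>
    then show "len K < 2 ^ n * len J"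
      using Suc.prems(2)[of J] that sub lens order_trans[of J K I] by auto
  qed
  have S: "?S I = a * len I + ?S ?l + ?S ?r"
    using sum_below_halves[OF G Suc.prems(1), of w] L by (simp add: a_def)
  have Q: "?Q I = a * len I * (?x I)\<^sup>2 + ?Q ?l + ?Q ?r"
    using sum_below_halves[OF G Suc.prems(1), of "\<lambda>J. w J * (?x J)\<^sup>2"] L by (simp add: a_def)
  have Spos: "?S K \<ge> 0" for K using w by (intro sum_nonneg) auto
  have Apos: "?A K > 0" for K using Spos[of K] M by (intro add_pos_nonneg) auto
  have a: "a \<ge> 0" unfolding a_def using w L by auto
  have A: "?A I = (?A ?l + ?A ?r) / 2 + a"
    unfolding S lens using L by (simp add: field_simps)
  have "?A I \<le> 2 * M"
    using carleson[OF Suc.prems(1)] L by (simp add: field_simps)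
  moreover have "?x I \<le> (?x ?l + ?x ?r) / 2"
    unfolding average_halves[OF f Suc.prems(1)]
    by (simp add: norm_divide norm_triangle_ineq)
  ultimately have B: "a * (?x I)\<^sup>2 + 4 * M\<^sup>2 * (?x I)\<^sup>2 / ?A I
      \<le> 2 * M\<^sup>2 * ((?x ?l)\<^sup>2 / ?A ?l + (?x ?r)\<^sup>2 / ?A ?r)"
    using bellman_inequality[of "?A ?l" "?A ?r" a M "?x I" "?x ?l" "?x ?r"] Apos a
    unfolding A by simp
  \<comment> \<open>Adding the estimates for the halves produces the right side of the Bellman
    inequality \<open>B\<close>; its gain, multiplied by \<open>|I|\<close>, cancels the new term
    that \<open>I\<close> adds to \<open>?Q I\<close>.\<close>
  have "?Q I \<le> a * len I * (?x I)\<^sup>2 + 4 * M * local_energy f I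
      - len I * (2 * M\<^sup>2 * ((?x ?l)\<^sup>2 / ?A ?l + (?x ?r)\<^sup>2 / ?A ?r))"
    using IH[of ?l] IH[of ?r]
    unfolding Q local_energy_halves[OF f Suc.prems(1)] lens by (simp add: algebra_simps)
  also have "\<dots> \<le> a * len I * (?x I)\<^sup>2 + 4 * M * local_energy f I
      - len I * (a * (?x I)\<^sup>2 + 4 * M\<^sup>2 * (?x I)\<^sup>2 / ?A I)"
    using mult_left_mono[OF B, of "len I"] L by linarith
  also have "\<dots> = 4 * M * local_energy f I - 4 * M\<^sup>2 * (len I * (?x I)\<^sup>2) / ?A I"
    by (simp add: algebra_simps)
  finally show ?case .
qed

text \<open>The local estimate is applied on each maximal member of \<open>G\<close>. These are
  disjoint and every member of \<open>G\<close> lies below exactly one of them, so their local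
  energies sum to at most the squared norm of \<open>f\<close>.\<close>

lemma carleson_embedding:
  fixes w :: "real set \<Rightarrow> real"
  assumes f: "sqint f" and G: "finite G" "G \<subseteq> dyadic_intervals"
    and w: "\<And>J. 0 \<le> w J" and M: "M > 0"
    and carleson: "\<And>I. I \<in> dyadic_intervals \<Longrightarrow> (\<Sum>J\<in>{J\<in>G. J \<subseteq> I}. w J) \<le> M * len I"
  shows "(\<Sum>J\<in>G. w J * (cmod (L2_inner f (haar 1 J)))\<^sup>2) \<le> 4 * M * (nrm f)\<^sup>2"
proof -
  let ?q = "\<lambda>J. w J * (cmod (L2_inner f (haar 1 J)))\<^sup>2"
  define T where "T = {I\<in>G. \<forall>J\<in>G. I \<subseteq> J \<longrightarrow> I = J}"
  have T: "finite T" "T \<subseteq> dyadic_intervals" using G by (auto simp: T_def)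
  have "disjoint T"
    unfolding disjoint_def
  proof (intro ballI impI)
    fix I J assume "I \<in> T" "J \<in> T" "I \<noteq> J"
    then show "I \<inter> J = {}"
      using dyadic_nested[of I J] T(2) by (auto simp: T_def)
  qed
  have cover: "(\<Union>I\<in>T. {J\<in>G. J \<subseteq> I}) = G"
  proof
    show "G \<subseteq> (\<Union>I\<in>T. {J\<in>G. J \<subseteq> I})"
    proof
      fix J assume "J \<in> G"
      obtain I where I: "I \<in> G" "J \<subseteq> I" "\<forall>K\<in>G. I \<subseteq> K \<longrightarrow> I = K"
        by (rule bexE[OF finite_has_maximal2[OF G(1) \<open>J \<in> G\<close>]]) simp
      then have "I \<in> T" unfolding T_def by simp
      moreover have "J \<in> {J\<in>G. J \<subseteq> I}" using \<open>J \<in> G\<close> I(2) by simp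
      ultimately show "J \<in> (\<Union>I\<in>T. {J\<in>G. J \<subseteq> I})" by (rule UN_I)
    qed
  qed auto
  have "(\<Sum>J\<in>G. ?q J) = (\<Sum>I\<in>T. \<Sum>J\<in>{J\<in>G. J \<subseteq> I}. ?q J)"
  proof -
    have "{J\<in>G. J \<subseteq> I} \<inter> {J\<in>G. J \<subseteq> I'} = {}" if "I \<in> T" "I' \<in> T" "I \<noteq> I'" for I I'
    proof -
      have "I \<inter> I' = {}" using \<open>disjoint T\<close> that by (simp add: disjoint_def)
      then have "J \<notin> G" if "J \<subseteq> I" "J \<subseteq> I'" for J
        using that dyadic_emptyI[of J] G(2) by auto
      then show ?thesis by auto
    qed
    then have "(\<Sum>J\<in>(\<Union>I\<in>T. {J\<in>G. J \<subseteq> I}). ?q J) = (\<Sum>I\<in>T. \<Sum>J\<in>{J\<in>G. J \<subseteq> I}. ?q J)"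
      using G(1) T(1) by (intro sum.UNION_disjoint) auto
    then show ?thesis unfolding cover .
  qed
  also have "\<dots> \<le> (\<Sum>I\<in>T. 4 * M * local_energy f I)"
  proof (rule sum_mono)
    fix I assume "I \<in> T"
    then have I: "I \<in> dyadic_intervals" using T by auto
    \<comment> \<open>Finiteness of \<open>G\<close> gives one generation bound \<open>n\<close> for
      all its members.\<close>
    have "\<exists>n. \<forall>J\<in>G. len I < 2 ^ n * len J"
    proof -
      have "\<exists>n. len I / len J < 2 ^ n" for J
        by (rule real_arch_pow) simp
      then obtain k where k: "len I / len J < 2 ^ k J" for J by metis
      have "len I < 2 ^ Max (k ` G) * len J" if "J \<in> G" for J
      proof -
        have J: "len J > 0" using len_pos that G by auto
        have "len I < 2 ^ k J * len J" using k[of J] J by (simp add: field_simps)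
        also have "\<dots> \<le> 2 ^ Max (k ` G) * len J"
          using J that G(1) by (intro mult_right_mono power_increasing) auto
        finally show ?thesis .
      qed
      then show ?thesis by blast
    qed
    then obtain n where "\<And>J. J \<in> G \<Longrightarrow> len I < 2 ^ n * len J" by blast
    then have "(\<Sum>J\<in>{J\<in>G. J \<subseteq> I}. ?q J) \<le> 4 * M * local_energy f I
        - 4 * M\<^sup>2 * (len I * (cmod (L2_inner f (haar 1 I)))\<^sup>2) /
          (M + (\<Sum>J\<in>{J\<in>G. J \<subseteq> I}. w J) / len I)"
      by (intro carleson_local[OF f G w M carleson I, where n = n])
    also have "\<dots> \<le> 4 * M * local_energy f I"
      using M w by (simp add: sum_nonneg add_nonneg_nonneg)
    finally show "(\<Sum>J\<in>{J\<in>G. J \<subseteq> I}. ?q J) \<le> 4 * M * local_energy f I" .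
  qed
  also have "\<dots> = 4 * M * (\<Sum>I\<in>T. local_energy f I)"
    by (simp add: sum_distrib_left)
  also have "\<dots> \<le> 4 * M * (nrm f)\<^sup>2"
    using sum_local_energy_le[OF f T \<open>disjoint T\<close>] M by (intro mult_left_mono) auto
  finally show ?thesis .
qed


section \<open>Density of the Haar functions\<close>

lemma haar_spanI:
  assumes "finite F" "F \<subseteq> dyadic_intervals"
  shows "(\<lambda>x. \<Sum>I\<in>F. c I * haar 0 I x) \<in> haar_span"
  using assms unfolding haar_span_def by blast

lemma haar_in_haar_span: "I \<in> dyadic_intervals \<Longrightarrow> haar 0 I \<in> haar_span"
  using haar_spanI[of "{I}" "\<lambda>_. 1"] by simp

lemma zero_in_haar_span: "(\<lambda>x. 0) \<in> haar_span"
  using haar_spanI[of "{}"] by simp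

lemma haar_span_scale:
  assumes "f \<in> haar_span"
  shows "(\<lambda>x. k * f x) \<in> haar_span"
proof -
  obtain F c where F: "finite F" "F \<subseteq> dyadic_intervals" "f = (\<lambda>x. \<Sum>I\<in>F. c I * haar 0 I x)"
    using assms unfolding haar_span_def by blast
  have "(\<lambda>x. k * f x) = (\<lambda>x. \<Sum>I\<in>F. (k * c I) * haar 0 I x)"
    unfolding F by (simp add: sum_distrib_left mult.assoc)
  then show ?thesis using haar_spanI[OF F(1,2)] by simp
qed

lemma haar_span_add:
  assumes "f \<in> haar_span" "g \<in> haar_span"
  shows "(\<lambda>x. f x + g x) \<in> haar_span"
proof -
  obtain F c where F: "finite F" "F \<subseteq> dyadic_intervals" "f = (\<lambda>x. \<Sum>I\<in>F. c I * haar 0 I x)"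
    using assms unfolding haar_span_def by blast
  obtain G e where G: "finite G" "G \<subseteq> dyadic_intervals" "g = (\<lambda>x. \<Sum>I\<in>G. e I * haar 0 I x)"
    using assms unfolding haar_span_def by blast
  \<comment> \<open>Both sums are extended by zero coefficients to the common index set
    \<open>F \<union> G\<close>.\<close>
  have ext: "(\<Sum>I\<in>H. u I * haar 0 I x) = (\<Sum>I\<in>F \<union> G. (if I \<in> H then u I else 0) * haar 0 I x)"
    if "H \<subseteq> F \<union> G" for H u x
    using that F(1) G(1) by (intro sum.mono_neutral_cong_left) auto
  have "(\<lambda>x. f x + g x) = (\<lambda>x. \<Sum>I\<in>F \<union> G.
      ((if I \<in> F then c I else 0) + (if I \<in> G then e I else 0)) * haar 0 I x)"
    unfolding F(3) G(3)
    by (simp only: ext[of F c] ext[of G e] Un_upper1 Un_upper2 sum.distrib[symmetric] distrib_right)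
  then show ?thesis using haar_spanI[of "F \<union> G"] F G by simp
qed

text \<open>The \<open>L^2\<close> closure of \<open>haar_span\<close>. It contains the averaging
  functions, which is the density that duality requires.\<close>

definition approximable :: "(real \<Rightarrow> complex) \<Rightarrow> bool" where
  "approximable f \<longleftrightarrow> sqint f \<and> (\<forall>e>0. \<exists>g\<in>haar_span. nrm (\<lambda>x. f x - g x) \<le> e)"

lemma approximable_zero: "approximable (\<lambda>x. 0)"
  unfolding approximable_def
  using zero_in_haar_span by (auto simp: sqint_zero nrm_def intro!: bexI[of _ "\<lambda>x. 0"])

lemma approximable_add:
  assumes "approximable f" "approximable g"
  shows "approximable (\<lambda>x. f x + g x)"
  unfolding approximable_def
proof (intro conjI allI impI)
  show "sqint (\<lambda>x. f x + g x)" using assms by (simp add: approximable_def sqint_add)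
  fix e :: real assume "e > 0"
  then obtain u v where u: "u \<in> haar_span" "nrm (\<lambda>x. f x - u x) \<le> e / 2"
    and v: "v \<in> haar_span" "nrm (\<lambda>x. g x - v x) \<le> e / 2"
    using assms unfolding approximable_def by (meson half_gt_zero)
  have "nrm (\<lambda>x. (f x - u x) + (g x - v x)) \<le> nrm (\<lambda>x. f x - u x) + nrm (\<lambda>x. g x - v x)"
    using assms haar_span_sqint[OF u(1)] haar_span_sqint[OF v(1)]
    by (intro nrm_triangle sqint_diff) (auto simp: approximable_def)
  then have "nrm (\<lambda>x. f x + g x - (u x + v x)) \<le> e"
    using u v by (simp add: algebra_simps)
  then show "\<exists>w\<in>haar_span. nrm (\<lambda>x. f x + g x - w x) \<le> e"
    using haar_span_add[OF u(1) v(1)] by (auto intro: bexI[of _ "\<lambda>x. u x + v x"])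
qed

lemma approximable_scale:
  assumes "approximable f"
  shows "approximable (\<lambda>x. k * f x)"
  unfolding approximable_def
proof (intro conjI allI impI)
  show "sqint (\<lambda>x. k * f x)" using assms by (simp add: approximable_def sqint_scale)
  fix e :: real assume "e > 0"
  \<comment> \<open>The added \<open>1\<close> covers \<open>k = 0\<close>.\<close>
  then have "e / (cmod k + 1) > 0" by (simp add: add_nonneg_pos)
  then obtain u where u: "u \<in> haar_span" "nrm (\<lambda>x. f x - u x) \<le> e / (cmod k + 1)"
    using assms unfolding approximable_def by blast
  have pos: "cmod k + 1 > 0" by (simp add: add_nonneg_pos)
  have "nrm (\<lambda>x. k * f x - k * u x) = cmod k * nrm (\<lambda>x. f x - u x)"
    using nrm_scale[of k "\<lambda>x. f x - u x"] by (simp add: right_diff_distrib)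
  also have "\<dots> \<le> (cmod k + 1) * nrm (\<lambda>x. f x - u x)"
    by (intro mult_right_mono) auto
  also have "\<dots> \<le> (cmod k + 1) * (e / (cmod k + 1))"
    using u(2) pos by (intro mult_left_mono) auto
  also have "\<dots> = e" using pos by simp
  finally show "\<exists>w\<in>haar_span. nrm (\<lambda>x. k * f x - w x) \<le> e"
    using haar_span_scale[OF u(1)] by (auto intro: bexI[of _ "\<lambda>x. k * u x"])
qed

text \<open>With \<open>P\<close> the parent of \<open>I\<close>, \<open>1\<^sub>I = 1\<^sub>P / 2 \<plusminus> (sqrt |P| / 2) h\<^sub>P\<close>. Iterating through the
  ancestors of \<open>I\<close>, the remainder is a multiple of the indicator of a very long interval, whose
  norm tends to zero.\<close>

lemma indicator_close_to_haar_span: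
  assumes "I \<in> dyadic_intervals"
  shows "\<exists>g\<in>haar_span. nrm (\<lambda>x. indicator I x - g x) \<le> sqrt (len I) / sqrt 2 ^ n"
  using assms
proof (induction n arbitrary: I)
  case 0
  have "(\<lambda>x. (cmod (indicator I x))\<^sup>2) = (indicator I :: real \<Rightarrow> real)"
    by (auto simp: indicator_def)
  then show ?case
    using 0 by (intro bexI[OF _ zero_in_haar_span]) (simp add: nrm_def)
next
  case (Suc n)
  obtain P where P: "P \<in> dyadic_intervals" "I = left_half P \<or> I = right_half P"
    using dyadic_parent[OF Suc.prems] by blast
  obtain g where g: "g \<in> haar_span" "nrm (\<lambda>x. indicator P x - g x) \<le> sqrt (len P) / sqrt 2 ^ n"
    using Suc.IH[OF P(1)] by blast
  have L: "len P = 2 * len I" "len P > 0"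
    using P len_half[OF P(1)] len_pos[OF P(1)] by auto
  define s :: complex where "s = (if I = left_half P then -1 else 1)"
  have I: "indicator I x = 1 / 2 * indicator P x + s * of_real (sqrt (len P)) / 2 * haar 0 P x" for x
    using P(2) halves_Un[of P] halves_disjoint[of P] L(2)
    by (auto simp: s_def haar_0_eq indicator_def)
  let ?g = "\<lambda>x. 1 / 2 * g x + s * of_real (sqrt (len P)) / 2 * haar 0 P x"
  have "nrm (\<lambda>x. indicator I x - ?g x) = nrm (\<lambda>x. 1 / 2 * (indicator P x - g x))"
    unfolding I by (simp add: algebra_simps)
  also have "\<dots> = nrm (\<lambda>x. indicator P x - g x) / 2"
    by (subst nrm_scale) simp
  also have "\<dots> \<le> sqrt (len P) / sqrt 2 ^ n / 2"
    using g(2) by simp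
  also have "\<dots> = sqrt (len I) / sqrt 2 ^ Suc n"
    unfolding L(1) by (simp add: real_sqrt_mult field_simps)
  finally show ?case
    using haar_span_add[OF haar_span_scale[OF g(1), of "1 / 2"]
        haar_span_scale[OF haar_in_haar_span[OF P(1)], of "s * of_real (sqrt (len P)) / 2"]]
    by (intro bexI[of _ ?g])
qed

lemma approximable_haar_1:
  assumes "I \<in> dyadic_intervals"
  shows "approximable (haar 1 I)"
proof -
  have "approximable (indicator I)"
    unfolding approximable_def
  proof (intro conjI allI impI)
    show "sqint (indicator I)" using assms by (rule sqint_indicator)
    fix e :: real assume e: "e > 0"
    obtain n where "sqrt (len I) / e < sqrt 2 ^ n"
      using real_arch_pow[of "sqrt 2"] by auto
    then have "sqrt (len I) / sqrt 2 ^ n \<le> e" using e by (simp add: field_simps)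
    then show "\<exists>g\<in>haar_span. nrm (\<lambda>x. indicator I x - g x) \<le> e"
      using indicator_close_to_haar_span[OF assms, of n] by (meson order_trans)
  qed
  then show ?thesis unfolding haar_1_eq by (rule approximable_scale)
qed

lemma approximable_haar_1_sum:
  assumes "finite F" "F \<subseteq> dyadic_intervals"
  shows "approximable (\<lambda>x. \<Sum>I\<in>F. c I * haar 1 I x)"
  using assms
proof (induction F rule: finite_induct)
  case empty
  then show ?case by (simp add: approximable_zero)
next
  case (insert J F)
  then have "approximable (\<lambda>x. c J * haar 1 J x + (\<Sum>I\<in>F. c I * haar 1 I x))"
    by (intro approximable_add approximable_scale approximable_haar_1) auto
  with insert.hyps show ?case by simp
qed


section \<open>Bounds on the norms as inequalities for finite sums\<close>

lemma ennsqrt_le_iff: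
  assumes "r \<ge> 0"
  shows "ennsqrt x \<le> ennreal r \<longleftrightarrow> x \<le> ennreal (r\<^sup>2)"
proof (cases x)
  case (real t)
  have "sqrt t \<le> r \<longleftrightarrow> t \<le> r\<^sup>2"
    using assms real real_le_rsqrt real_sqrt_le_iff sqrt_le_D
    by (metis abs_of_nonneg real_sqrt_abs)
  then show ?thesis using real assms by (simp add: ennsqrt_def)
next
  case top
  then show ?thesis by (simp add: ennsqrt_def top_unique)
qed

text \<open>An unordered sum in \<open>ennreal\<close> is the supremum of its finite partial sums,
  so real bounds can be tested on finite index sets.\<close>

lemma infsum_ennreal_le_iff:
  fixes f :: "'a \<Rightarrow> real"
  assumes "\<And>x. f x \<ge> 0" "r \<ge> 0"
  shows "(\<Sum>\<^sub>\<infinity>x\<in>A. ennreal (f x)) \<le> ennreal r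
    \<longleftrightarrow> (\<forall>F. finite F \<longrightarrow> F \<subseteq> A \<longrightarrow> sum f F \<le> r)"
  using assms
  by (subst nonneg_infsum_complete) (auto simp: SUP_le_iff sum_nonneg)

lemma haar_series_norm_le_iff:
  assumes "r \<ge> 0"
  shows "haar_series_norm c \<le> ennreal r \<longleftrightarrow>
    (\<forall>G. finite G \<longrightarrow> G \<subseteq> dyadic_intervals \<longrightarrow> (\<Sum>I\<in>G. (cmod (c I))\<^sup>2) \<le> r\<^sup>2)"
  unfolding haar_series_norm_def ennsqrt_le_iff[OF assms]
  by (rule infsum_ennreal_le_iff) auto

lemma CM_norm_le_iff:
  assumes "r \<ge> 0"
  shows "CM_norm a \<le> ennreal r \<longleftrightarrow>
    (\<forall>I\<in>dyadic_intervals. \<forall>G. finite G \<longrightarrow> G \<subseteq> {J\<in>dyadic_intervals. J \<subseteq> I} \<longrightarrow>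
      (\<Sum>J\<in>G. (cmod (a J))\<^sup>2) \<le> r\<^sup>2 * len I)"
proof -
  \<comment> \<open>Clearing the denominator must also cover an infinite sum, for which both
    inequalities fail.\<close>
  have scale: "ennreal (1 / L) * X \<le> ennreal s \<longleftrightarrow> X \<le> ennreal (s * L)" if "L > 0" "s \<ge> 0" for L s X
  proof (cases X)
    case (real t)
    then show ?thesis using that
      by (simp add: ennreal_mult[symmetric] field_simps)
  next
    case top
    then show ?thesis using that by (simp add: ennreal_mult_top top_unique)
  qed
  have "CM_norm a \<le> ennreal r \<longleftrightarrow> (\<forall>I\<in>dyadic_intervals.
      ennreal (1 / len I) * (\<Sum>\<^sub>\<infinity>J\<in>{J\<in>dyadic_intervals. J \<subseteq> I}. ennreal ((cmod (a J))\<^sup>2)) \<le> ennreal (r\<^sup>2))"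
    unfolding CM_norm_def ennsqrt_le_iff[OF assms] by (simp add: SUP_le_iff)
  also have "\<dots> \<longleftrightarrow> (\<forall>I\<in>dyadic_intervals.
      (\<Sum>\<^sub>\<infinity>J\<in>{J\<in>dyadic_intervals. J \<subseteq> I}. ennreal ((cmod (a J))\<^sup>2)) \<le> ennreal (r\<^sup>2 * len I))"
    by (intro ball_cong refl scale len_pos) auto
  also have "\<dots> \<longleftrightarrow> (\<forall>I\<in>dyadic_intervals. \<forall>G. finite G \<longrightarrow> G \<subseteq> {J\<in>dyadic_intervals. J \<subseteq> I} \<longrightarrow>
      (\<Sum>J\<in>G. (cmod (a J))\<^sup>2) \<le> r\<^sup>2 * len I)"
    by (intro ball_cong refl infsum_ennreal_le_iff) auto
  finally show ?thesis .
qed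

lemma linf_norm_le_iff:
  assumes "r \<ge> 0"
  shows "linf_norm a \<le> ennreal r \<longleftrightarrow> (\<forall>I\<in>dyadic_intervals. cmod (a I) \<le> r)"
  unfolding linf_norm_def using assms by (simp add: SUP_le_iff)

lemma op_norm_le_iff:
  "op_norm N T \<le> y \<longleftrightarrow> (\<forall>f\<in>haar_span. nrm f \<le> 1 \<longrightarrow> N (T f) \<le> y)"
  unfolding op_norm_def
  by (auto simp: SUP_le_iff L2_norm_eq haar_span_sqint)

lemma norm_00_01_le_iff:
  assumes "r \<ge> 0"
  shows "norm_00_01 b d \<le> ennreal r \<longleftrightarrow>
    (\<forall>f\<in>haar_span. nrm f \<le> 1 \<longrightarrow> (\<forall>G. finite G \<longrightarrow> G \<subseteq> dyadic_intervals \<longrightarrow>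
      (\<Sum>I\<in>G. (cmod (b I * d I))\<^sup>2 * (cmod (L2_inner f (haar 1 I)))\<^sup>2) \<le> r\<^sup>2))"
  unfolding norm_00_01_def op_norm_le_iff haar_series_norm_le_iff[OF assms]
  by (simp add: series_paraproduct_00_def paraproduct_0_def norm_mult power_mult_distrib mult.assoc)

text \<open>By Parseval's identity the unit ball of \<open>haar_span\<close> consists of the
  finitely supported coefficient families in the unit ball of \<open>l^2\<close>.\<close>

lemma ball_haar_span_iff:
  "(\<forall>f\<in>haar_span. nrm f \<le> 1 \<longrightarrow> Q f) \<longleftrightarrow>
    (\<forall>F c. finite F \<longrightarrow> F \<subseteq> dyadic_intervals \<longrightarrow> (\<Sum>I\<in>F. (cmod (c I))\<^sup>2) \<le> 1 \<longrightarrow>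
      Q (\<lambda>x. \<Sum>I\<in>F. c I * haar 0 I x))"
proof -
  have iff: "nrm (\<lambda>x. \<Sum>I\<in>F. c I * haar 0 I x) \<le> 1 \<longleftrightarrow> (\<Sum>I\<in>F. (cmod (c I))\<^sup>2) \<le> 1"
    if "finite F" "F \<subseteq> dyadic_intervals" for F c
    unfolding nrm_haar_sum[OF that, symmetric] by (simp add: abs_square_le_1)
  show ?thesis
  proof (intro iffI allI impI ballI)
    fix F and c :: "real set \<Rightarrow> complex"
    assume Q: "\<forall>f\<in>haar_span. nrm f \<le> 1 \<longrightarrow> Q f"
      and F: "finite F" "F \<subseteq> dyadic_intervals" "(\<Sum>I\<in>F. (cmod (c I))\<^sup>2) \<le> 1"
    show "Q (\<lambda>x. \<Sum>I\<in>F. c I * haar 0 I x)"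
      by (rule Q[rule_format, OF haar_spanI[OF F(1,2)] iffD2[OF iff[OF F(1,2)] F(3)]])
  next
    fix f
    assume Q: "\<forall>F c. finite F \<longrightarrow> F \<subseteq> dyadic_intervals \<longrightarrow> (\<Sum>I\<in>F. (cmod (c I))\<^sup>2) \<le> 1 \<longrightarrow>
        Q (\<lambda>x. \<Sum>I\<in>F. c I * haar 0 I x)"
      and f: "f \<in> haar_span" "nrm f \<le> 1"
    obtain F c where F: "finite F" "F \<subseteq> dyadic_intervals" and eq: "f = (\<lambda>x. \<Sum>I\<in>F. c I * haar 0 I x)"
      using f(1) unfolding haar_span_def by blast
    show "Q f"
      unfolding eq by (rule Q[rule_format, OF F iffD1[OF iff[OF F] f(2)[unfolded eq]]])
  qed
qed

text \<open>By orthonormality the composition multiplies the coefficient at \<open>I\<close> by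
  \<open>b I * d I\<close>; coefficients outside \<open>F\<close> are zero, hence the
  conditional.\<close>

lemma norm_00_00_le_iff:
  assumes "r \<ge> 0"
  shows "norm_00_00 b d \<le> ennreal r \<longleftrightarrow>
    (\<forall>F c. finite F \<longrightarrow> F \<subseteq> dyadic_intervals \<longrightarrow> (\<Sum>I\<in>F. (cmod (c I))\<^sup>2) \<le> 1 \<longrightarrow>
      (\<forall>G. finite G \<longrightarrow> G \<subseteq> dyadic_intervals \<longrightarrow>
        (\<Sum>I\<in>G. (cmod (b I * d I))\<^sup>2 * (cmod (if I \<in> F then c I else 0))\<^sup>2) \<le> r\<^sup>2))"
proof -
  have *: "(\<Sum>I\<in>G. (cmod (series_paraproduct_00 b (paraproduct_0 0 d (\<lambda>x. \<Sum>I\<in>F. c I * haar 0 I x)) I))\<^sup>2)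
      = (\<Sum>I\<in>G. (cmod (b I * d I))\<^sup>2 * (cmod (if I \<in> F then c I else 0))\<^sup>2)"
    if "finite F" "F \<subseteq> dyadic_intervals" "G \<subseteq> dyadic_intervals" for F c G
  proof (rule sum.cong[OF refl])
    fix I assume "I \<in> G"
    then have "I \<in> dyadic_intervals" using that by auto
    then show "(cmod (series_paraproduct_00 b (paraproduct_0 0 d (\<lambda>x. \<Sum>I\<in>F. c I * haar 0 I x)) I))\<^sup>2
      = (cmod (b I * d I))\<^sup>2 * (cmod (if I \<in> F then c I else 0))\<^sup>2"
      by (simp only: series_paraproduct_00_def paraproduct_0_def haar_coefficient[OF that(1,2)]
          norm_mult power_mult_distrib mult.assoc)
  qed
  show ?thesis
    unfolding norm_00_00_def op_norm_le_iff haar_series_norm_le_iff[OF assms] ball_haar_span_iff comp_def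
    by (intro iff_allI imp_cong refl arg_cong2[where f = "(\<le>)"] *)
qed

text \<open>Haar coefficients off \<open>F\<close> vanish, so the infinite sum reduces to a sum over
  \<open>F\<close>.\<close>

lemma paraproduct_10_haar_sum:
  assumes "finite F" "F \<subseteq> dyadic_intervals"
  shows "series_paraproduct_10 b (paraproduct_0 0 d (\<lambda>x. \<Sum>I\<in>F. c I * haar 0 I x))
    = (\<lambda>x. \<Sum>I\<in>F. (b I * d I * c I) * haar 1 I x)"
proof
  fix x
  have "series_paraproduct_10 b (paraproduct_0 0 d (\<lambda>x. \<Sum>I\<in>F. c I * haar 0 I x)) x
      = (\<Sum>\<^sub>\<infinity>I\<in>F. (b I * d I * c I) * haar 1 I x)"
    unfolding series_paraproduct_10_def paraproduct_0_def
    using assms by (intro infsum_cong_neutral) (auto simp: haar_coefficient)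
  then show "series_paraproduct_10 b (paraproduct_0 0 d (\<lambda>x. \<Sum>I\<in>F. c I * haar 0 I x)) x
      = (\<Sum>I\<in>F. (b I * d I * c I) * haar 1 I x)"
    using assms(1) by simp
qed

lemma norm_10_00_le_iff:
  assumes "r \<ge> 0"
  shows "norm_10_00 b d \<le> ennreal r \<longleftrightarrow>
    (\<forall>F c. finite F \<longrightarrow> F \<subseteq> dyadic_intervals \<longrightarrow> (\<Sum>I\<in>F. (cmod (c I))\<^sup>2) \<le> 1 \<longrightarrow>
      nrm (\<lambda>x. \<Sum>I\<in>F. (b I * d I * c I) * haar 1 I x) \<le> r)"
proof -
  have "L2_norm (\<lambda>x. \<Sum>I\<in>F. (b I * d I * c I) * haar 1 I x) \<le> ennreal r
      \<longleftrightarrow> nrm (\<lambda>x. \<Sum>I\<in>F. (b I * d I * c I) * haar 1 I x) \<le> r"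
    if "finite F" "F \<subseteq> dyadic_intervals" for F c
    using approximable_haar_1_sum[OF that, of "\<lambda>I. b I * d I * c I"] assms
    unfolding approximable_def by (simp add: L2_norm_eq)
  then show ?thesis
    unfolding norm_10_00_def op_norm_le_iff ball_haar_span_iff comp_def
    by (simp add: paraproduct_10_haar_sum)
qed

section \<open>From real bounds to comparability\<close>

text \<open>A finite \<open>y\<close> is itself one of the real bounds \<open>r\<close>; for
  infinite \<open>y\<close> the right side is infinite because \<open>C > 0\<close>.\<close>

lemma ennreal_le_multI:
  assumes "C > 0" "\<And>r. r \<ge> 0 \<Longrightarrow> y \<le> ennreal r \<Longrightarrow> x \<le> ennreal (C * r)"
  shows "x \<le> ennreal C * y"
proof (cases y)
  case (real r)
  then show ?thesis using assms(1) assms(2)[of r] by (simp add: ennreal_mult)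
next
  case top
  then show ?thesis using assms(1) by (simp add: ennreal_mult_top)
qed

text \<open>The factor \<open>2\<close> in each direction yields the constants
  \<open>c = 1/2\<close> and \<open>C = 2\<close>.\<close>

lemma comparableI:
  assumes "\<And>b d r. r \<ge> 0 \<Longrightarrow> B b d \<le> ennreal r \<Longrightarrow> A b d \<le> ennreal (2 * r)"
    and "\<And>b d r. r \<ge> 0 \<Longrightarrow> A b d \<le> ennreal r \<Longrightarrow> B b d \<le> ennreal (2 * r)"
  shows "comparable A B"
  unfolding comparable_def
proof (intro exI conjI allI)
  fix b d
  have "B b d \<le> ennreal 2 * A b d" using assms(2) by (intro ennreal_le_multI) auto
  then have "ennreal (1 / 2) * B b d \<le> ennreal (1 / 2) * (ennreal 2 * A b d)"
    by (rule mult_left_mono) simp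
  also have "\<dots> = ennreal (1 / 2 * 2) * A b d"
    by (subst ennreal_mult) (auto simp: mult.assoc)
  finally show "ennreal (1 / 2) * B b d \<le> A b d" by simp
  show "A b d \<le> ennreal 2 * B b d" using assms(1) by (intro ennreal_le_multI) auto
qed auto

lemma comparable_finite_iff:
  assumes "comparable A B"
  shows "A b d < \<infinity> \<longleftrightarrow> B b d < \<infinity>"
proof -
  obtain c C where c: "0 < c" and B: "ennreal c * B b d \<le> A b d" and A: "A b d \<le> ennreal C * B b d"
    using assms unfolding comparable_def by blast
  show ?thesis
  proof
    assume "A b d < \<infinity>"
    then have "ennreal c * B b d < top" using B by (simp add: le_less_trans)
    then show "B b d < \<infinity>" using c by (auto simp: ennreal_mult_less_top)
  next
    assume "B b d < \<infinity>"
    then have "ennreal C * B b d < top" by (simp add: ennreal_mult_less_top)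
    then show "A b d < \<infinity>" using A by (simp add: le_less_trans)
  qed
qed


section \<open>The two-sided bounds\<close>

text \<open>Carleson embedding with weights \<open>|b_I d_I|^2\<close>. Its constant
  \<open>4 M\<close> with \<open>M\<close> close to \<open>r^2\<close> becomes
  \<open>(2 r)^2\<close>, the source of the factor \<open>2\<close>.\<close>

lemma CM_norm_le_imp_norm_00_01_le:
  assumes r: "r \<ge> 0" and CM: "CM_norm (\<lambda>I. b I * d I) \<le> ennreal r"
  shows "norm_00_01 b d \<le> ennreal (2 * r)"
proof -
  have "(\<Sum>I\<in>G. (cmod (b I * d I))\<^sup>2 * (cmod (L2_inner f (haar 1 I)))\<^sup>2) \<le> (2 * r)\<^sup>2"
    if f: "f \<in> haar_span" "nrm f \<le> 1" and G: "finite G" "G \<subseteq> dyadic_intervals" for f G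
  proof (rule dense_ge)
    fix y assume y: "(2 * r)\<^sup>2 < y"
    \<comment> \<open>\<open>carleson_embedding\<close> needs \<open>M > 0\<close> while
      \<open>r\<close> may be \<open>0\<close>; hence the bound is shown for every \<open>y\<close>
      above \<open>(2 r)^2\<close>.\<close>
    define M where "M = y / 4"
    have "r\<^sup>2 < M" using y by (simp add: M_def power_mult_distrib)
    moreover have "0 \<le> r\<^sup>2" by simp
    ultimately have M: "r\<^sup>2 \<le> M" "0 < M" by linarith+
    have "(\<Sum>I\<in>G. (cmod (b I * d I))\<^sup>2 * (cmod (L2_inner f (haar 1 I)))\<^sup>2) \<le> 4 * M * (nrm f)\<^sup>2"
    proof (rule carleson_embedding[OF haar_span_sqint[OF f(1)] G _ M(2)])
      fix I assume I: "I \<in> dyadic_intervals"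
      have "(\<Sum>J\<in>{J\<in>G. J \<subseteq> I}. (cmod (b J * d J))\<^sup>2) \<le> r\<^sup>2 * len I"
        by (rule CM[unfolded CM_norm_le_iff[OF r], rule_format, OF I]) (use G in auto)
      also have "\<dots> \<le> M * len I" using M len_pos[OF I] by (intro mult_right_mono) auto
      finally show "(\<Sum>J\<in>{J\<in>G. J \<subseteq> I}. (cmod (b J * d J))\<^sup>2) \<le> M * len I" .
    qed simp
    also have "\<dots> \<le> 4 * M * 1"
      using f(2) M by (intro mult_left_mono) (auto simp: power_le_one)
    finally show "(\<Sum>I\<in>G. (cmod (b I * d I))\<^sup>2 * (cmod (L2_inner f (haar 1 I)))\<^sup>2) \<le> y"
      by (simp add: M_def)
  qed
  then show ?thesis using r by (subst norm_00_01_le_iff) auto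
qed

text \<open>The test function is the Haar function of the parent of \<open>I\<close>, whose averages over all
  \<open>J \<subseteq> I\<close> have the same modulus.\<close>

lemma norm_00_01_le_imp_CM_norm_le:
  assumes r: "r \<ge> 0" and le: "norm_00_01 b d \<le> ennreal r"
  shows "CM_norm (\<lambda>I. b I * d I) \<le> ennreal (2 * r)"
proof -
  have "(\<Sum>J\<in>G. (cmod (b J * d J))\<^sup>2) \<le> (2 * r)\<^sup>2 * len I"
    if I: "I \<in> dyadic_intervals" and G: "finite G" "G \<subseteq> {J\<in>dyadic_intervals. J \<subseteq> I}" for I G
  proof -
    obtain P where P: "P \<in> dyadic_intervals" "I = left_half P \<or> I = right_half P"
      using dyadic_parent[OF I] by blast
    have L: "len P = 2 * len I" "len I > 0"
      using P len_half[OF P(1)] len_pos[OF I] by auto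
    have avg: "(cmod (L2_inner (haar 0 P) (haar 1 J)))\<^sup>2 = 1 / (2 * len I)" if "J \<in> G" for J
    proof -
      have J: "J \<in> dyadic_intervals" "J \<subseteq> left_half P \<or> J \<subseteq> right_half P"
        using that G P by auto
      then have "cmod (L2_inner (haar 0 P) (haar 1 J)) = 1 / sqrt (len P)"
        using average_haar_left[OF J(1), of P] average_haar_right[OF J(1), of P] L
        by (auto simp: norm_divide)
      then show ?thesis using L by (simp add: power_divide)
    qed
    have "(\<Sum>J\<in>G. (cmod (b J * d J))\<^sup>2 * (cmod (L2_inner (haar 0 P) (haar 1 J)))\<^sup>2) \<le> r\<^sup>2"
      by (rule le[unfolded norm_00_01_le_iff[OF r], rule_format, OF haar_in_haar_span[OF P(1)]])
        (use nrm_haar_0[OF P(1)] G in auto)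
    then have "(\<Sum>J\<in>G. (cmod (b J * d J))\<^sup>2) * (1 / (2 * len I)) \<le> r\<^sup>2"
      by (simp add: avg sum_divide_distrib)
    then have "(\<Sum>J\<in>G. (cmod (b J * d J))\<^sup>2) \<le> 2 * r\<^sup>2 * len I"
      using L by (simp add: field_simps)
    \<comment> \<open>The parent is twice as long as \<open>I\<close>, so the argument gives the
      factor \<open>sqrt 2\<close>; it is rounded up to the common constant
      \<open>2\<close>.\<close>
    also have "\<dots> \<le> (2 * r)\<^sup>2 * len I"
      using L by (intro mult_right_mono) (auto simp: power_mult_distrib)
    finally show ?thesis .
  qed
  then show ?thesis using r by (subst CM_norm_le_iff) auto
qed

section \<open>Duality between the two operators of part (i)\<close>

lemma integral_haar_1_sum:
  assumes "finite F" "F \<subseteq> dyadic_intervals" "sqint g"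
  shows "(LINT x|lborel. (\<Sum>I\<in>F. e I * haar 1 I x) * g x) = (\<Sum>I\<in>F. e I * L2_inner g (haar 1 I))"
proof -
  have "L2_inner (\<lambda>x. \<Sum>I\<in>F. e I * haar 1 I x) (\<lambda>x. cnj (g x))
      = (\<Sum>I\<in>F. e I * L2_inner (haar 1 I) (\<lambda>x. cnj (g x)))"
    using assms by (intro L2_inner_sum sqint_cnj sqint_haar_1) auto
  then show ?thesis by (simp add: L2_inner_def mult.commute)
qed

text \<open>The \<open>l^2\<close> norm of the image coefficients \<open>v\<close> is attained by
  pairing with a unit vector. That vector is fed into the other operator, and Cauchy-Schwarz against
  \<open>f\<close> finishes.\<close>

lemma norm_10_00_le_imp_norm_00_01_le:
  assumes r: "r \<ge> 0" and le: "norm_10_00 b d \<le> ennreal r"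
  shows "norm_00_01 b d \<le> ennreal r"
proof -
  have "(\<Sum>I\<in>G. (cmod (b I * d I))\<^sup>2 * (cmod (L2_inner f (haar 1 I)))\<^sup>2) \<le> r\<^sup>2"
    if f: "f \<in> haar_span" "nrm f \<le> 1" and G: "finite G" "G \<subseteq> dyadic_intervals" for f G
  proof -
    define v where "v I = b I * d I * L2_inner f (haar 1 I)" for I
    define s where "s = sqrt (\<Sum>I\<in>G. (cmod (v I))\<^sup>2)"
    have s: "s \<ge> 0" "s\<^sup>2 = (\<Sum>I\<in>G. (cmod (v I))\<^sup>2)"
      by (auto simp: s_def sum_nonneg)
    have "s \<le> r"
    proof (cases "s = 0")
      case True
      then show ?thesis using r by simp
    next
      case False
      \<comment> \<open>The normalised conjugate of \<open>v\<close> is the extremal unit vector: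
        the pairing of \<open>?g\<close> with \<open>f\<close> then equals \<open>s\<close>.\<close>
      define c where "c I = cnj (v I) / of_real s" for I
      let ?g = "\<lambda>x. \<Sum>I\<in>G. (b I * d I * c I) * haar 1 I x"
      have "(\<Sum>I\<in>G. (cmod (c I))\<^sup>2) = 1"
        using False s(2)[symmetric]
        by (simp add: c_def norm_divide power_divide sum_divide_distrib[symmetric])
      then have g: "nrm ?g \<le> r"
        by (intro le[unfolded norm_10_00_le_iff[OF r], rule_format] G) simp
      have "(LINT x|lborel. ?g x * f x) = (\<Sum>I\<in>G. v I * cnj (v I) / of_real s)"
        unfolding integral_haar_1_sum[OF G haar_span_sqint[OF f(1)]]
        by (simp add: c_def v_def ac_simps)
      also have "\<dots> = of_real (s\<^sup>2 / s)"
        unfolding s(2) by (simp only: of_real_divide of_real_sum complex_norm_square sum_divide_distrib)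
      finally have "s = cmod (LINT x|lborel. ?g x * f x)"
        using s(1) False by (simp add: power2_eq_square)
      also have "\<dots> \<le> nrm ?g * nrm f"
        using approximable_haar_1_sum[OF G] haar_span_sqint[OF f(1)]
        by (intro cauchy_schwarz_integral) (auto simp: approximable_def)
      also have "\<dots> \<le> r * 1" using g f(2) r by (intro mult_mono) auto
      finally show ?thesis by simp
    qed
    then have "s\<^sup>2 \<le> r\<^sup>2" using s(1) by (intro power_mono)
    then show ?thesis unfolding s(2) v_def by (simp add: norm_mult power_mult_distrib)
  qed
  then show ?thesis using r by (subst norm_00_01_le_iff) auto
qed

text \<open>Pairings of \<open>?g\<close> with Haar sums are controlled by the other operator.
  Density lets the test function tend to the conjugate of \<open>?g\<close>, so the squared norm of
  \<open>?g\<close> is at most \<open>r\<close> times its norm.\<close>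

lemma norm_00_01_le_imp_norm_10_00_le:
  assumes r: "r \<ge> 0" and le: "norm_00_01 b d \<le> ennreal r"
  shows "norm_10_00 b d \<le> ennreal r"
proof -
  have "nrm (\<lambda>x. \<Sum>I\<in>F. (b I * d I * c I) * haar 1 I x) \<le> r"
    if F: "finite F" "F \<subseteq> dyadic_intervals" and c: "(\<Sum>I\<in>F. (cmod (c I))\<^sup>2) \<le> 1" for F c
  proof -
    let ?g = "\<lambda>x. \<Sum>I\<in>F. (b I * d I * c I) * haar 1 I x"
    have g: "sqint ?g" using approximable_haar_1_sum[OF F] by (auto simp: approximable_def)
    \<comment> \<open>An arbitrary positive \<open>t\<close> above \<open>nrm f\<close> allows
      normalisation even when \<open>f\<close> has norm \<open>0\<close>.\<close>
    have pair: "cmod (LINT x|lborel. ?g x * f x) \<le> r * t"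
      if f: "f \<in> haar_span" and t: "nrm f \<le> t" "t > 0" for f t
    proof -
      let ?h = "\<lambda>x. of_real (1 / t) * f x"
      have h: "?h \<in> haar_span" "nrm ?h \<le> 1"
        using haar_span_scale[OF f, of "of_real (1 / t)"] t
        by (simp_all only: nrm_scale) (simp add: norm_divide)
      define v where "v I = b I * d I * L2_inner ?h (haar 1 I)" for I
      have v: "(\<Sum>I\<in>F. (cmod (v I))\<^sup>2) \<le> r\<^sup>2"
        using le[unfolded norm_00_01_le_iff[OF r], rule_format, OF h F]
        by (simp only: v_def norm_mult power_mult_distrib mult.assoc)
      have "(LINT x|lborel. ?g x * ?h x) = (\<Sum>I\<in>F. c I * v I)"
        unfolding integral_haar_1_sum[OF F haar_span_sqint[OF h(1)]]
        by (simp add: v_def ac_simps)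
      also have "cmod \<dots> \<le> (\<Sum>I\<in>F. cmod (c I) * cmod (v I))"
        by (rule order_trans[OF norm_sum]) (simp add: norm_mult)
      also have "\<dots> \<le> sqrt (\<Sum>I\<in>F. (cmod (c I))\<^sup>2) * sqrt (\<Sum>I\<in>F. (cmod (v I))\<^sup>2)"
        using L2_set_mult_ineq[of "\<lambda>I. cmod (c I)" "\<lambda>I. cmod (v I)" F] by (simp add: L2_set_def)
      also have "\<dots> \<le> 1 * r"
        using c v r by (intro mult_mono real_le_lsqrt) (auto simp: sum_nonneg)
      finally have "cmod (LINT x|lborel. ?g x * ?h x) \<le> r" by simp
      moreover have "(\<lambda>x. ?g x * ?h x) = (\<lambda>x. of_real (1 / t) * (?g x * f x))"
        by (simp add: ac_simps)
      ultimately have "cmod (of_real (1 / t) * (LINT x|lborel. ?g x * f x)) \<le> r"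
        by (simp only: integral_mult_right_zero)
      then show ?thesis using t by (simp add: norm_mult norm_divide field_simps)
    qed
    have bound: "(nrm ?g)\<^sup>2 \<le> nrm ?g * e + r * (nrm ?g + e)" if e: "e > 0" for e
    proof -
      \<comment> \<open>The pairing carries no conjugate, so the norm of \<open>?g\<close> is
        recovered by pairing with its conjugate. As averaging functions are real valued, that
        conjugate is again a finite sum of them, hence approximable.\<close>
      let ?G = "\<lambda>x. cnj (?g x)"
      have "?G = (\<lambda>x. \<Sum>I\<in>F. cnj (b I * d I * c I) * haar 1 I x)"
        by (simp only: cnj_sum complex_cnj_mult cnj_haar)
      then have "approximable ?G"
        using approximable_haar_1_sum[OF F, of "\<lambda>I. cnj (b I * d I * c I)"] by simp
      then obtain u where u: "u \<in> haar_span" "nrm (\<lambda>x. ?G x - u x) \<le> e"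
        using e unfolding approximable_def by blast
      note us = haar_span_sqint[OF u(1)] and Gs = sqint_cnj[OF g]
      have "nrm u \<le> nrm ?g + e"
        using nrm_le_add_diff[OF Gs us] nrm_cnj[of ?g] u(2) by linarith
      moreover have "nrm ?g + e > 0" using e by (simp add: add_nonneg_pos)
      ultimately have bound_u: "cmod (LINT x|lborel. ?g x * u x) \<le> r * (nrm ?g + e)"
        by (rule pair[OF u(1)])
      have bound_diff: "cmod (LINT x|lborel. ?g x * (?G x - u x)) \<le> nrm ?g * e"
        using cauchy_schwarz_integral[OF g sqint_diff[OF Gs us]] mult_left_mono[OF u(2) nrm_nonneg]
        by (rule order_trans)
      have split: "(LINT x|lborel. ?g x * ?G x)
          = (LINT x|lborel. ?g x * (?G x - u x)) + (LINT x|lborel. ?g x * u x)"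
        using integrable_prod[OF g sqint_diff[OF Gs us]] integrable_prod[OF g us]
        by (subst Bochner_Integration.integral_add[symmetric]) (simp_all only: distrib_left[symmetric] diff_add_cancel)
      have "(nrm ?g)\<^sup>2 = cmod (L2_inner ?g ?g)"
        unfolding L2_inner_self[OF g] by (simp add: norm_power)
      also have "\<dots> \<le> nrm ?g * e + r * (nrm ?g + e)"
        unfolding L2_inner_def split by (rule norm_triangle_le[OF add_mono[OF bound_diff bound_u]])
      finally show ?thesis .
    qed
    have "(nrm ?g)\<^sup>2 \<le> nrm ?g * 0 + r * (nrm ?g + 0)"
    proof (rule tendsto_lowerbound)
      show "((\<lambda>e. nrm ?g * e + r * (nrm ?g + e)) \<longlongrightarrow> nrm ?g * 0 + r * (nrm ?g + 0)) (at_right 0)"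
        by (intro tendsto_intros)
      show "\<forall>\<^sub>F e in at_right 0. (nrm ?g)\<^sup>2 \<le> nrm ?g * e + r * (nrm ?g + e)"
        using bound by (rule eventually_mono[OF eventually_at_right_less])
    qed simp
    then have "nrm ?g * nrm ?g \<le> r * nrm ?g" by (simp add: power2_eq_square)
    then show ?thesis
      using r nrm_nonneg[of ?g] by (cases "nrm ?g = 0") (simp_all add: mult_le_cancel_right)
  qed
  then show ?thesis using r by (subst norm_10_00_le_iff) auto
qed

text \<open>Both norms have the same real upper bounds; the multiplicative constant is
  \<open>1\<close>.\<close>

lemma norm_00_01_eq_norm_10_00: "norm_00_01 b d = norm_10_00 b d"
proof (rule antisym)
  show "norm_00_01 b d \<le> norm_10_00 b d"
    using ennreal_le_multI[of 1 "norm_10_00 b d" "norm_00_01 b d"] norm_10_00_le_imp_norm_00_01_le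
    by simp
  show "norm_10_00 b d \<le> norm_00_01 b d"
    using ennreal_le_multI[of 1 "norm_00_01 b d" "norm_10_00 b d"] norm_00_01_le_imp_norm_10_00_le
    by simp
qed

text \<open>The composition is diagonal. A single Haar function detects \<open>|b_I d_I|\<close>,
  and conversely the supremum factors out of the \<open>l^2\<close> sum, so the norms are equal and
  not merely comparable.\<close>

lemma norm_00_00_eq_linf_norm: "norm_00_00 b d = linf_norm (\<lambda>I. b I * d I)"
proof -
  have *: "norm_00_00 b d \<le> ennreal r \<longleftrightarrow> linf_norm (\<lambda>I. b I * d I) \<le> ennreal r" if r: "r \<ge> 0" for r
  proof
    assume le: "norm_00_00 b d \<le> ennreal r"
    have "cmod (b I * d I) \<le> r" if I: "I \<in> dyadic_intervals" for I
    proof -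
      have "(\<Sum>J\<in>{I}. (cmod (b J * d J))\<^sup>2 * (cmod (if J \<in> {I} then 1 else 0))\<^sup>2) \<le> r\<^sup>2"
        using le[unfolded norm_00_00_le_iff[OF r], rule_format, of "{I}" "\<lambda>_. 1" "{I}"] I by simp
      then have "(cmod (b I * d I))\<^sup>2 \<le> r\<^sup>2" by simp
      then show ?thesis using r by (rule power2_le_imp_le)
    qed
    then show "linf_norm (\<lambda>I. b I * d I) \<le> ennreal r"
      using r by (simp add: linf_norm_le_iff)
  next
    assume le: "linf_norm (\<lambda>I. b I * d I) \<le> ennreal r"
    have "(\<Sum>I\<in>G. (cmod (b I * d I))\<^sup>2 * (cmod (if I \<in> F then c I else 0))\<^sup>2) \<le> r\<^sup>2"
      if F: "finite F" and c: "(\<Sum>I\<in>F. (cmod (c I))\<^sup>2) \<le> 1"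
        and G: "finite G" "G \<subseteq> dyadic_intervals" for F G and c :: "real set \<Rightarrow> complex"
    proof -
      have "(cmod (b I * d I))\<^sup>2 \<le> r\<^sup>2" if "I \<in> G" for I
        using le that G unfolding linf_norm_le_iff[OF r] by (intro power_mono) auto
      then have "(\<Sum>I\<in>G. (cmod (b I * d I))\<^sup>2 * (cmod (if I \<in> F then c I else 0))\<^sup>2)
          \<le> (\<Sum>I\<in>G. r\<^sup>2 * (cmod (if I \<in> F then c I else 0))\<^sup>2)"
        by (intro sum_mono mult_right_mono) auto
      also have "\<dots> = r\<^sup>2 * (\<Sum>I\<in>G \<inter> F. (cmod (c I))\<^sup>2)"
        unfolding sum_distrib_left[symmetric] using G(1)
        by (intro arg_cong[where f = "(*) (r\<^sup>2)"] sum.mono_neutral_cong_right) auto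
      also have "\<dots> \<le> r\<^sup>2 * (\<Sum>I\<in>F. (cmod (c I))\<^sup>2)"
        using F by (intro mult_left_mono sum_mono2) auto
      also have "\<dots> \<le> r\<^sup>2 * 1" using c by (intro mult_left_mono) auto
      finally show ?thesis by simp
    qed
    then show "norm_00_00 b d \<le> ennreal r" using r by (subst norm_00_00_le_iff) blast+
  qed
  show ?thesis
    using ennreal_le_multI[of 1 "norm_00_00 b d" "linf_norm (\<lambda>I. b I * d I)"]
      ennreal_le_multI[of 1 "linf_norm (\<lambda>I. b I * d I)" "norm_00_00 b d"] *
    by (intro antisym) simp_all
qed

theorem theorem1p2:
  shows
    "(\<forall>b d :: real set \<Rightarrow> complex.
        (norm_00_01 b d < \<infinity> \<longleftrightarrow> CM_norm (\<lambda>I. b I * d I) < \<infinity>) \<and>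
        (norm_10_00 b d < \<infinity> \<longleftrightarrow> CM_norm (\<lambda>I. b I * d I) < \<infinity>) \<and>
        norm_00_01 b d = norm_10_00 b d) \<and>
     comparable norm_00_01 (\<lambda>b d. CM_norm (\<lambda>I. b I * d I)) \<and>
     comparable norm_10_00 (\<lambda>b d. CM_norm (\<lambda>I. b I * d I)) \<and>
     (\<forall>b d :: real set \<Rightarrow> complex.
        norm_00_00 b d < \<infinity> \<longleftrightarrow> linf_norm (\<lambda>I. b I * d I) < \<infinity>) \<and>
     comparable norm_00_00 (\<lambda>b d. linf_norm (\<lambda>I. b I * d I))"
proof -
  \<comment> \<open>With this equality the claims for \<open>norm_10_00\<close> repeat those for
    \<open>norm_00_01\<close>.\<close>
  have eq: "norm_10_00 = norm_00_01"
    by (intro ext) (simp add: norm_00_01_eq_norm_10_00)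
  have CM: "comparable norm_00_01 (\<lambda>b d. CM_norm (\<lambda>I. b I * d I))"
    by (intro comparableI CM_norm_le_imp_norm_00_01_le norm_00_01_le_imp_CM_norm_le)
  \<comment> \<open>Equality of the norms allows both constants to be \<open>1\<close>.\<close>
  have linf: "comparable norm_00_00 (\<lambda>b d. linf_norm (\<lambda>I. b I * d I))"
    unfolding norm_00_00_eq_linf_norm comparable_def
    by (intro exI[of _ 1]) simp
  show ?thesis
    unfolding eq using CM linf comparable_finite_iff[OF CM] comparable_finite_iff[OF linf] by simp
qed

end
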